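(* Let $f_1,\dots,f_m\colon\mathbb{R}^d\to\mathbb{R}\cup\{+\infty\}$ be closed, convex and proper, let $\tau>0$, and let $W\in\mathbb{R}^{m\times m}$ be a (symmetric) mixing matrix. Suppose $\mathcal{I}^0,\mathcal{I}^1,\ldots$ are sampled IID from a distribution on $[0,1]^m$ satisfying the uniform expected step-size condition $\mathbb{E}[\mathcal{I}]=\alpha\mathbf{1}$ with $\alpha\in(0,1]$. Consider the algorithm RC-PG-EXTRA (written out in full in the context) run with $\mathcal{I}=\mathcal{I}^0,\mathcal{I}^1,\ldots$ in its successive passes. If the minimum eigenvalue of the symmetric mixing matrix $W$ satisfies $$\lambda_{\min}(W)>-\frac{\alpha}{2-\alpha},$$ then the normalized iterate of RC-PG-EXTRA (the iterate after $k$ passes of the main loop, divided by $k$) converges to $-\alpha\mathbf{v}$ as $k\to\infty$, both in $L^2$ and almost surely, where $\mathbf{v}$ is the infimal displacement vector of PG-EXTRA.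
   Context: Agents $1,\dots,m$ are the nodes of a network, and $N_i$ is the set of agents connected to agent $i$. A mixing matrix is a symmetric $W\in\mathbb{R}^{m\times m}$ with $W_{ij}=0$ whenever $i\ne j$ and $j\notin N_i$, all of whose eigenvalues $\lambda$ satisfy $|\lambda|\le1$, and with $\ker(I-W)=\mathrm{span}(\mathbf{1})$, where $\mathbf{1}\in\mathbb{R}^m$ is the all-ones vector. $\mathrm{Prox}_{\tau f}(y)=\arg\min_x\{\tau f(x)+\tfrac12\|x-y\|^2\}$. PG-EXTRA, a decentralized method for minimizing $\sum_{i=1}^mf_i(x)$ over $x\in\mathbb{R}^d$, is the iteration $$x_i^{k+1}=\mathrm{Prox}_{\tau f_i}\Big(\sum_{j=1}^mW_{ij}x_j^k-w_i^k\Big),\qquad w_i^{k+1}=w_i^k+\tfrac12\Big(x_i^k-\sum_{j=1}^mW_{ij}x_j^k\Big),\qquad i=1,\dots,m.$$ Algorithm RC-PG-EXTRA. Agent $i$ stores $x_i$, $w_i$ and a vector denoted $[Wx]_i$, all in $\mathbb{R}^d$. The steps, where $=$ denotes assignment, are: (1) For $i\in\{1,\dots,m\}$, initialize $w_i=0$, $x_i=0$, $[Wx]_i=0$. (2) For $j\in\{1,\dots,m\}$, update $w_j=w_j+\frac{\alpha}{2}(x_i-[Wx]_i)$. (3) Main loop; each pass does the following. Sample $\mathcal{I}$. For each $i$ such that $\mathcal{I}_i\ne0$: (3a) set $\Delta x_i=\mathrm{Prox}_{\tau f_i}([Wx]_i-w_i)-x_i$; (3b) update $x_i=x_i+\mathcal{I}_i\Delta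 x_i$; (3c) for each $j\in N_i\cup\{i\}$: send $\Delta x_i$ from agent $i$ to agent $j$, then set $[Wx]_j=[Wx]_j+W_{ij}\Delta x_i$, then set $w_j=w_j+\frac{\alpha}{2}(x_i-[Wx]_i)$. The iterate consists of $(x_1,\dots,x_m)$ and $(w_1,\dots,w_m)$. Infimal displacement vector of PG-EXTRA. Write $\mathbf{x}\in\mathbb{R}^{m\times d}$ for the matrix with rows $x_i^\top$, and let $U$ be the symmetric positive semidefinite matrix with $U^2=\frac12(I-W)$. With $\mathbf{w}=\tau U\mathbf{u}$, PG-EXTRA is the fixed-point iteration of the (Condat–Vũ) operator $$\mathbb{T}(\mathbf{x},\mathbf{u})=\Big(\mathrm{Prox}_{\tau f}(W\mathbf{x}-\tau U\mathbf{u}),\ \mathbf{u}+\tfrac1\tau U\mathbf{x}\Big)\quad\text{on }\mathbb{R}^{m\times d}\times\mathbb{R}^{m\times d},$$ where $\mathrm{Prox}_{\tau f}$ acts on row $i$ as $\mathrm{Prox}_{\tau f_i}$. $\mathbb{T}$ is non-expansive with respect to the norm $\|(\mathbf{x},\mathbf{u})\|_M^2=\frac1\tau\|\mathbf{x}\|^2+2\,\mathrm{tr}(\mathbf{x}^\top U\mathbf{u})+\tau\|\mathbf{u}\|^2$ (Frobenius norms). Let $(\mathbf{v}_x,\mathbf{v}_u)$ be the infimal displacement vector of $\mathbb{T}$, i.e. the unique minimum-$\|\cdot\|_M$ element of $\overline{\mathrm{range}(\mathrm{Id}-\mathbb{T})}$. The infimal displacement vector of PG-EXTRA is $\mathbf{v}=(\mathbf{v}_x,\tau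 U\mathbf{v}_u)$, in the variables $(\mathbf{x},\mathbf{w})$.
   Formalization: The listing as written can diverge (m=1, W=1, f(x)=x, I=α=1/2); in the version proved, [Wx]_j gains W_ij I_i Δx_i, every w_j is updated once per pass by (α/2)(x_j−[Wx]_j), and the prox and w steps use start-of-pass values. *)

theory Defs
  imports "HOL-Probability.Probability"
begin

text \<open>Agents are indexed by a finite type \<open>'m\<close>. An element \<open>x :: real^'d^'m\<close> is an
  \<open>m \<times> d\<close> matrix whose row \<open>x $ i\<close> is the vector held by agent \<open>i\<close>; its \<open>norm\<close> is the Frobenius
  norm, and \<open>W ** x\<close> is the matrix product.\<close>

section \<open>Closed convex proper functions and the proximal operator\<close>

definition closed_fun :: "('a::euclidean_space \<Rightarrow> ereal) \<Rightarrow> bool" where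
  "closed_fun f \<longleftrightarrow> closed {(x, t::real). f x \<le> ereal t}"

definition convex_fun :: "('a::euclidean_space \<Rightarrow> ereal) \<Rightarrow> bool" where
  "convex_fun f \<longleftrightarrow> convex {(x, t::real). f x \<le> ereal t}"

definition proper_fun :: "('a \<Rightarrow> ereal) \<Rightarrow> bool" where
  "proper_fun f \<longleftrightarrow> (\<forall>x. f x \<noteq> -\<infinity>) \<and> (\<exists>x. f x \<noteq> \<infinity>)"

text \<open>For closed convex proper \<open>f\<close> and \<open>\<tau> > 0\<close> the minimiser is unique, so the choice made by
  \<open>ARG_MIN\<close> is immaterial.\<close>

definition prox :: "real \<Rightarrow> ('a::euclidean_space \<Rightarrow> ereal) \<Rightarrow> 'a \<Rightarrow> 'a" where
  "prox \<tau> f y = (ARG_MIN (\<lambda>x. ereal \<tau> * f x + ereal (1 / 2 * (norm (x - y))\<^sup>2)) x. True)"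

definition prox_rows ::
  "real \<Rightarrow> ('m::finite \<Rightarrow> real^'d \<Rightarrow> ereal) \<Rightarrow> real^'d^'m \<Rightarrow> real^'d^'m" where
  "prox_rows \<tau> f y = (\<chi> i. prox \<tau> (f i) (y $ i))"


section \<open>Mixing matrices\<close>

text \<open>Only real eigenvalues are collected; the notion is used for symmetric matrices, all of whose
  eigenvalues are real.\<close>

definition eigenvalues :: "real^'m^'m \<Rightarrow> real set" where
  "eigenvalues A = {l. \<exists>v. v \<noteq> 0 \<and> A *v v = l *\<^sub>R v}"

definition min_eigenvalue :: "real^'m^'m \<Rightarrow> real" where
  "min_eigenvalue A = Min (eigenvalues A)"

definition mixing_matrix :: "('m::finite \<Rightarrow> 'm set) \<Rightarrow> real^'m^'m \<Rightarrow> bool" where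
  "mixing_matrix N W \<longleftrightarrow>
     transpose W = W \<and>
     (\<forall>i j. i \<noteq> j \<and> j \<notin> N i \<longrightarrow> W $ i $ j = 0) \<and>
     (\<forall>l \<in> eigenvalues W. \<bar>l\<bar> \<le> 1) \<and>
     {v. (mat 1 - W) *v v = 0} = span {vec 1}"


section \<open>The infimal displacement vector of PG-EXTRA\<close>

definition psd :: "real^'m^'m \<Rightarrow> bool" where
  "psd A \<longleftrightarrow> transpose A = A \<and> (\<forall>v. 0 \<le> v \<bullet> (A *v v))"

text \<open>A symmetric positive semidefinite matrix has exactly one such root; \<open>I - W\<close> is positive
  semidefinite for every mixing matrix \<open>W\<close>.\<close>

definition psd_sqrt :: "real^'m^'m \<Rightarrow> real^'m^'m" where
  "psd_sqrt A = (SOME U. psd U \<and> U ** U = A)"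

definition U_of :: "real^'m^'m \<Rightarrow> real^'m^'m" where
  "U_of W = psd_sqrt ((1 / 2) *\<^sub>R (mat 1 - W))"

definition pg_extra_op ::
  "real \<Rightarrow> ('m::finite \<Rightarrow> real^'d \<Rightarrow> ereal) \<Rightarrow> real^'m^'m
    \<Rightarrow> (real^'d^'m) \<times> (real^'d^'m) \<Rightarrow> (real^'d^'m) \<times> (real^'d^'m)" where
  "pg_extra_op \<tau> f W = (\<lambda>(x, u).
     (prox_rows \<tau> f (W ** x - \<tau> *\<^sub>R (U_of W ** u)), u + (1 / \<tau>) *\<^sub>R (U_of W ** x)))"

definition norm_M :: "real \<Rightarrow> real^'m^'m \<Rightarrow> (real^'d^'m) \<times> (real^'d^'m) \<Rightarrow> real" where
  "norm_M \<tau> W = (\<lambda>(x, u).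
     sqrt (1 / \<tau> * (norm x)\<^sup>2 + 2 * trace (transpose x ** (U_of W ** u)) + \<tau> * (norm u)\<^sup>2))"

text \<open>Whenever all eigenvalues of \<open>W\<close> exceed \<open>-1\<close>, \<open>norm_M\<close> is a norm, the closure below (taken in
  the standard topology) agrees with the closure for \<open>norm_M\<close>, and the minimiser is unique.\<close>

definition infimal_displacement ::
  "('a::topological_ab_group_add \<Rightarrow> real) \<Rightarrow> ('a \<Rightarrow> 'a) \<Rightarrow> 'a" where
  "infimal_displacement nrm T = (ARG_MIN nrm v. v \<in> closure (range (\<lambda>z. z - T z)))"

definition pg_extra_infimal_displacement ::
  "real \<Rightarrow> ('m::finite \<Rightarrow> real^'d \<Rightarrow> ereal) \<Rightarrow> real^'m^'m \<Rightarrow> (real^'d^'m) \<times> (real^'d^'m)" where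
  "pg_extra_infimal_displacement \<tau> f W =
     (let (vx, vu) = infimal_displacement (norm_M \<tau> W) (pg_extra_op \<tau> f W)
      in (vx, \<tau> *\<^sub>R (U_of W ** vu)))"


section \<open>RC-PG-EXTRA\<close>

text \<open>A state is \<open>(x, w, Wx)\<close>, where row \<open>j\<close> of \<open>Wx\<close> is the stored vector \<open>[Wx]\<^sub>j\<close>.

  One pass with sample \<open>s\<close> is read as the randomised coordinate version of PG-EXTRA that the step-size
  condition \<open>E[s] = \<alpha> 1\<close> describes: block \<open>x\<^sub>i\<close> is relaxed by \<open>s\<^sub>i\<close>, and \<open>w\<close> by the constant \<open>\<alpha>\<close>.
  The printed listing of the algorithm has to be corrected for this:

  \<^item> agent \<open>i\<close> sends the increment \<open>s\<^sub>i \<Delta>x\<^sub>i\<close> actually applied to \<open>x\<^sub>i\<close>, so that \<open>[Wx]\<^sub>j\<close> remains equal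
    to \<open>\<Sum>\<^sub>i W\<^sub>i\<^sub>j x\<^sub>i\<close>; the listing accumulates \<open>W\<^sub>i\<^sub>j \<Delta>x\<^sub>i\<close>;
  \<^item> every \<open>w\<^sub>j\<close> is updated once per pass with agent \<open>j\<close>'s own \<open>x\<^sub>j - [Wx]\<^sub>j\<close>; the listing writes
    \<open>x\<^sub>i - [Wx]\<^sub>i\<close> in the update of \<open>w\<^sub>j\<close> and repeats it for each received message;
  \<^item> as in the PG-EXTRA recursion, both the proximal step and the \<open>w\<close> update use the values stored
    at the beginning of the pass.

  Taken verbatim, the listing does not have the limit \<open>-\<alpha> v\<close>: for a single agent, \<open>W = 1\<close>, \<open>f(x) = x\<close>
  and constant samples \<open>s = \<alpha> = 1/2\<close>, its iterates grow exponentially.\<close>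

definition dual_update ::
  "real \<Rightarrow> real^'d^'m::finite \<Rightarrow> real^'d^'m \<Rightarrow> real^'d^'m \<Rightarrow> real^'d^'m" where
  "dual_update \<alpha> x w Wx = (\<chi> j. w $ j + (\<alpha> / 2) *\<^sub>R (x $ j - Wx $ j))"

definition rc_init :: "real \<Rightarrow> (real^'d^'m::finite) \<times> (real^'d^'m) \<times> (real^'d^'m)" where
  "rc_init \<alpha> = (0, dual_update \<alpha> 0 0 0, 0)"

definition rc_pass ::
  "real \<Rightarrow> real \<Rightarrow> ('m::finite \<Rightarrow> real^'d \<Rightarrow> ereal) \<Rightarrow> ('m \<Rightarrow> 'm set) \<Rightarrow> real^'m^'m \<Rightarrow> real^'m
    \<Rightarrow> (real^'d^'m) \<times> (real^'d^'m) \<times> (real^'d^'m)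
    \<Rightarrow> (real^'d^'m) \<times> (real^'d^'m) \<times> (real^'d^'m)" where
  "rc_pass \<alpha> \<tau> f N W s = (\<lambda>(x, w, Wx).
     let \<Delta> = (\<lambda>i. prox \<tau> (f i) (Wx $ i - w $ i) - x $ i)
     in (\<chi> i. if s $ i \<noteq> 0 then x $ i + (s $ i) *\<^sub>R \<Delta> i else x $ i,
         dual_update \<alpha> x w Wx,
         \<chi> j. Wx $ j + (\<Sum>i | s $ i \<noteq> 0 \<and> j \<in> N i \<union> {i}. (W $ i $ j) *\<^sub>R (s $ i) *\<^sub>R \<Delta> i)))"

primrec rc_state ::
  "real \<Rightarrow> real \<Rightarrow> ('m::finite \<Rightarrow> real^'d \<Rightarrow> ereal) \<Rightarrow> ('m \<Rightarrow> 'm set) \<Rightarrow> real^'m^'m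
    \<Rightarrow> (nat \<Rightarrow> real^'m) \<Rightarrow> nat \<Rightarrow> (real^'d^'m) \<times> (real^'d^'m) \<times> (real^'d^'m)" where
  "rc_state \<alpha> \<tau> f N W S 0 = rc_init \<alpha>"
| "rc_state \<alpha> \<tau> f N W S (Suc k) = rc_pass \<alpha> \<tau> f N W (S k) (rc_state \<alpha> \<tau> f N W S k)"

definition rc_iterate ::
  "real \<Rightarrow> real \<Rightarrow> ('m::finite \<Rightarrow> real^'d \<Rightarrow> ereal) \<Rightarrow> ('m \<Rightarrow> 'm set) \<Rightarrow> real^'m^'m
    \<Rightarrow> (nat \<Rightarrow> real^'m) \<Rightarrow> nat \<Rightarrow> (real^'d^'m) \<times> (real^'d^'m)" where
  "rc_iterate \<alpha> \<tau> f N W S k = (case rc_state \<alpha> \<tau> f N W S k of (x, w, Wx) \<Rightarrow> (x, w))"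


section \<open>Random samples and modes of convergence\<close>

definition uniform_expected_step_size :: "real \<Rightarrow> (real^'m::finite) measure \<Rightarrow> bool" where
  "uniform_expected_step_size \<alpha> D \<longleftrightarrow>
     prob_space D \<and> sets D = sets borel \<and>
     (AE s in D. \<forall>i. 0 \<le> s $ i \<and> s $ i \<le> 1) \<and>
     (\<integral>s. s \<partial>D) = \<alpha> *\<^sub>R vec 1"

definition iid_samples :: "'w measure \<Rightarrow> 'a::topological_space measure \<Rightarrow> (nat \<Rightarrow> 'w \<Rightarrow> 'a) \<Rightarrow> bool" where
  "iid_samples M D X \<longleftrightarrow>
     prob_space.indep_vars M (\<lambda>_. borel) X UNIV \<and> (\<forall>k. distr M borel (X k) = D)"

text \<open>Square integrability is required explicitly, because the Bochner integral of a non-integrable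
  function is 0.\<close>

definition converges_L2 ::
  "'w measure \<Rightarrow> (nat \<Rightarrow> 'w \<Rightarrow> 'a::euclidean_space) \<Rightarrow> 'a \<Rightarrow> bool" where
  "converges_L2 M Z c \<longleftrightarrow>
     (\<forall>k. Z k \<in> borel_measurable M \<and> integrable M (\<lambda>\<omega>. (norm (Z k \<omega>))\<^sup>2)) \<and>
     (\<lambda>k. \<integral>\<omega>. (norm (Z k \<omega> - c))\<^sup>2 \<partial>M) \<longlonglongrightarrow> 0"

end

theory Submission
  imports Defs
begin

text \<open>Put \<open>w = \<tau> U u\<close> and \<open>S = Id - T\<close> for the PG-EXTRA operator \<open>T\<close>. A pass of the algorithm is
  then \<open>z \<mapsto> z - \<Lambda> s (S z)\<close> on \<open>z = (x, u)\<close>, where \<open>\<Lambda> s\<close> scales the primal blocks by the sample and the dual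
  variable by \<open>\<alpha>\<close> (\<open>rc_state_eq_randomized_orbit\<close>), so that its mean is multiplication by \<open>\<alpha>\<close>. In the
  metric of \<open>norm_M\<close> the operator \<open>T\<close> is firmly nonexpansive (\<open>displacement_firm\<close>), and a linear change of
  variables turns this metric into the standard one (\<open>positive_definite_isometry\<close>).

  The random iterate \<open>z k\<close> is compared with the deterministic orbit \<open>y (k+1) = y k - \<alpha> S (y k)\<close>. For the
  latter \<open>y k / k\<close> converges to \<open>-\<alpha>\<close> times the least element of the closure of the range of \<open>S\<close>
  (\<open>relaxed_orbit_average_tendsto\<close>). For the difference \<open>e k = z k - y k\<close>, firm nonexpansiveness decreases the
  squared norm in a step by \<open>\<alpha> (2 - \<alpha>) \<bar>S (z k) - S (y k)\<bar>\<^sup>2\<close>, while the randomness increases its expectation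
  by at most \<open>c \<bar>S (z k)\<bar>\<^sup>2\<close>. The variance of a sample with mean \<open>\<alpha>\<close> in \<open>[0,1]\<close> is at most
  \<open>\<alpha> (1 - \<alpha>)\<close>, and the metric controls the primal part with the constant \<open>\<kappa> = (1 + \<lambda>) / 2\<close>, where \<open>\<lambda>\<close> is
  the least eigenvalue of \<open>W\<close>, so \<open>c = \<alpha> (1 - \<alpha>) / \<kappa>\<close> (\<open>block_scaling_second_moment\<close>).
  The hypothesis on \<open>\<lambda>\<close> yields \<open>c < \<alpha> (2 - \<alpha>)\<close>. Since \<open>S (y k)\<close> is bounded, it follows that
  \<open>E \<bar>e (k+1)\<bar>\<^sup>2 + gap * E \<bar>S (z k) - S (y k)\<bar>\<^sup>2 \<le> E \<bar>e k\<bar>\<^sup>2 + drift\<close> (\<open>expected_one_step\<close>).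

  Hence \<open>E \<bar>e k\<bar>\<^sup>2\<close> grows at most linearly, which is the convergence in \<open>L\<^sup>2\<close>. For almost sure
  convergence the same inequality shows that the series of \<open>\<bar>e k\<bar>\<^sup>2 / (k + 1) powr (5/2)\<close> and
  \<open>\<bar>e (k+1) - e k\<bar>\<^sup>2 / (k + 1) powr (3/2)\<close> converge almost surely, and on every path where they do
  \<open>e k / k\<close> tends to 0 (\<open>scaled_sequence_tendsto_zero\<close>).\<close>

section \<open>Self-adjoint operators and symmetric matrices\<close>

text \<open>Compactness of the unit sphere of \<open>V\<close> gives a maximiser of the Rayleigh quotient, and the first-order
  condition there is the eigenvalue equation.\<close>

lemma rayleigh_maximum_is_eigenvector:
  fixes A :: "'a::euclidean_space \<Rightarrow> 'a"
  assumes A: "linear A" and sym: "\<And>x y. A x \<bullet> y = x \<bullet> A y"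
    and V: "subspace V" "A ` V \<subseteq> V" and ne: "V \<noteq> {0}"
  obtains b l where "b \<in> V" "norm b = 1" "A b = l *\<^sub>R b" "\<And>x. x \<in> V \<Longrightarrow> x \<bullet> A x \<le> l * (norm x)\<^sup>2"
proof -
  interpret A: linear A by (rule A)
  let ?K = "sphere 0 1 \<inter> V"
  have cont: "continuous_on T A" for T
    using A by (simp add: linear_continuous_on linear_conv_bounded_linear)
  obtain w where w: "w \<in> V" "w \<noteq> 0" using ne V(1) subspace_0 by blast
  then have "(1 / norm w) *\<^sub>R w \<in> ?K" using V(1) by (auto simp: subspace_scale)
  then have "?K \<noteq> {}" by blast
  moreover have "compact ?K" using V(1) by (intro compact_Int_closed) (auto simp: closed_subspace)
  moreover have "continuous_on ?K (\<lambda>x. x \<bullet> A x)" by (intro continuous_intros cont)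
  ultimately obtain b where b: "b \<in> ?K" and max: "\<And>x. x \<in> ?K \<Longrightarrow> x \<bullet> A x \<le> b \<bullet> A b"
    using continuous_attains_sup[of ?K "\<lambda>x. x \<bullet> A x"] by blast
  define l where "l = b \<bullet> A b"
  have nb: "norm b = 1" and bV: "b \<in> V" using b by auto
  have bound: "x \<bullet> A x \<le> l * (norm x)\<^sup>2" if "x \<in> V" for x
  proof (cases "x = 0")
    case False
    have "(1 / norm x) *\<^sub>R x \<in> ?K" using False V(1) that by (auto simp: subspace_scale)
    from max[OF this] have "(1 / norm x) * (1 / norm x) * (x \<bullet> A x) \<le> l"
      by (simp add: A.scaleR l_def)
    then show ?thesis using False by (simp add: field_simps power2_eq_square)
  qed (simp add: A.zero)
  define r where "r = l *\<^sub>R b - A b"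
  have rV: "r \<in> V" unfolding r_def using V bV by (auto simp: subspace_diff subspace_scale)
  \<comment> \<open>The form \<open>l\<bar>x\<bar>\<^sup>2 - x \<bullet> A x\<close> is nonnegative on \<open>V\<close> and vanishes at \<open>b\<close>, so its first
    variation at \<open>b\<close> in the direction of the residual \<open>r\<close>, which is \<open>2 \<bar>r\<bar>\<^sup>2\<close>, is zero.\<close>
  have quad: "0 \<le> 2 * t * (norm r)\<^sup>2 + t\<^sup>2 * (l * (norm r)\<^sup>2 - r \<bullet> A r)" for t
  proof -
    have bb: "b \<bullet> b = 1" using nb by (simp add: dot_square_norm)
    have "b + t *\<^sub>R r \<in> V" using V(1) bV rV by (simp add: subspace_add subspace_scale)
    from bound[OF this] have "0 \<le> l * ((b + t *\<^sub>R r) \<bullet> (b + t *\<^sub>R r)) - (b + t *\<^sub>R r) \<bullet> A (b + t *\<^sub>R r)"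
      by (simp add: dot_square_norm)
    also have "\<dots> = 2 * t * (l * (r \<bullet> b) - r \<bullet> A b) + t\<^sup>2 * (l * (r \<bullet> r) - r \<bullet> A r)"
      using sym[of b r] by (simp add: A.add A.scaleR inner_add_left inner_add_right bb l_def[symmetric]
          algebra_simps power2_eq_square inner_commute)
    also have "l * (r \<bullet> b) - r \<bullet> A b = (norm r)\<^sup>2"
    proof -
      have "l * (r \<bullet> b) - r \<bullet> A b = r \<bullet> r" by (simp add: r_def inner_diff_right)
      then show ?thesis by (simp add: dot_square_norm)
    qed
    finally show ?thesis by (simp add: dot_square_norm)
  qed
  have "norm r = 0"
  proof (rule ccontr)
    assume "norm r \<noteq> 0"
    then have pos: "(norm r)\<^sup>2 > 0" by simp
    define q where "q = l * (norm r)\<^sup>2 - r \<bullet> A r"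
    have q: "q \<ge> 0" using bound[OF rV] by (simp add: q_def)
    define t where "t = - (norm r)\<^sup>2 / (q + 1)"
    have t: "t < 0" using pos q by (simp add: t_def divide_neg_pos)
    have "0 \<le> t * (2 * (norm r)\<^sup>2 + t * q)" using quad[of t] by (simp add: q_def algebra_simps power2_eq_square)
    then have "2 * (norm r)\<^sup>2 + t * q \<le> 0" using t by (simp add: zero_le_mult_iff)
    moreover have "- t * q \<le> (norm r)\<^sup>2" using q pos by (simp add: t_def field_simps)
    ultimately show False using pos by simp
  qed
  then have "A b = l *\<^sub>R b" by (simp add: r_def)
  then show ?thesis using that bV nb bound by blast
qed

text \<open>The spectral theorem, by induction on the dimension of the invariant subspace: split off an
  eigenvector of the largest Rayleigh quotient, whose orthogonal complement is again invariant.\<close>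

lemma orthonormal_eigenbasis_exists:
  fixes A :: "'a::euclidean_space \<Rightarrow> 'a"
  assumes A: "linear A" and sym: "\<And>x y. A x \<bullet> y = x \<bullet> A y"
    and V: "subspace V" "A ` V \<subseteq> V"
  shows "\<exists>B. pairwise orthogonal B \<and> (\<forall>b\<in>B. norm b = 1 \<and> A b = (b \<bullet> A b) *\<^sub>R b) \<and> span B = V"
  using V
proof (induction "dim V" arbitrary: V rule: less_induct)
  case less
  interpret A: linear A by (rule A)
  show ?case
  proof (cases "V = {0}")
    case True
    then show ?thesis by (intro exI[of _ "{}"]) auto
  next
    case False
    obtain b l where b: "b \<in> V" "norm b = 1" "A b = l *\<^sub>R b"
      using rayleigh_maximum_is_eigenvector[OF A sym less.prems False] by metis
    have bb: "b \<bullet> b = 1" using b by (simp add: dot_square_norm)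
    define V' where "V' = V \<inter> {x. b \<bullet> x = 0}"
    have sub: "subspace V'" unfolding V'_def
      using less.prems(1) by (intro subspace_inter subspace_hyperplane)
    have inv: "A ` V' \<subseteq> V'"
    proof safe
      fix x assume x: "x \<in> V'"
      have "b \<bullet> A x = l * (b \<bullet> x)" using sym[of b x] b by simp
      then show "A x \<in> V'" using x less.prems(2) by (auto simp: V'_def)
    qed
    have "b \<notin> V'" using bb by (simp add: V'_def)
    moreover have "V' \<subseteq> V" by (simp add: V'_def)
    ultimately have "V' \<subset> V" using b(1) by blast
    then have "dim V' < dim V"
      using sub less.prems(1) by (intro dim_psubset) (simp add: span_eq_iff[THEN iffD2])
    from less.hyps[OF this sub inv] obtain B where B: "pairwise orthogonal B"
      "\<forall>b\<in>B. norm b = 1 \<and> A b = (b \<bullet> A b) *\<^sub>R b" "span B = V'" by blast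
    have BV': "B \<subseteq> V'" using B(3) span_superset by blast
    have "span (insert b B) = V"
    proof
      show "span (insert b B) \<subseteq> V"
        using b BV' less.prems(1) by (intro span_minimal) (auto simp: V'_def)
      show "V \<subseteq> span (insert b B)"
      proof
        fix x assume x: "x \<in> V"
        have "x - (b \<bullet> x) *\<^sub>R b \<in> V'"
          using x b less.prems(1) bb by (auto simp: V'_def subspace_diff subspace_scale inner_diff_right)
        then show "x \<in> span (insert b B)" using B(3) by (auto simp: span_insert)
      qed
    qed
    moreover have "pairwise orthogonal (insert b B)"
      using B(1) BV' by (auto simp: pairwise_insert orthogonal_def V'_def inner_commute)
    moreover have "\<forall>b\<in>insert b B. norm b = 1 \<and> A b = (b \<bullet> A b) *\<^sub>R b"
      using B(2) b bb by auto
    ultimately show ?thesis by blast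
  qed
qed

lemma selfadjoint_orthonormal_expansion:
  fixes A :: "'a::euclidean_space \<Rightarrow> 'a"
  assumes A: "linear A" and sym: "\<And>x y. A x \<bullet> y = x \<bullet> A y"
  obtains B where "finite B" "\<And>b c. b \<in> B \<Longrightarrow> c \<in> B \<Longrightarrow> b \<bullet> c = (if b = c then 1 else 0)"
    "\<And>b. b \<in> B \<Longrightarrow> A b = (b \<bullet> A b) *\<^sub>R b" "\<And>x. x = (\<Sum>b\<in>B. (b \<bullet> x) *\<^sub>R b)"
proof -
  obtain B where B: "pairwise orthogonal B"
      "\<forall>b\<in>B. norm b = 1 \<and> A b = (b \<bullet> A b) *\<^sub>R b" "span B = UNIV"
    using orthonormal_eigenbasis_exists[OF A sym, of UNIV] by auto
  have fin: "finite B" using B(1) pairwise_orthogonal_imp_finite by blast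
  have o: "b \<bullet> c = (if b = c then 1 else 0)" if "b \<in> B" "c \<in> B" for b c
    using B(1,2) that by (auto simp: pairwise_def orthogonal_def dot_square_norm)
  have "x = (\<Sum>b\<in>B. (b \<bullet> x) *\<^sub>R b)" for x
  proof -
    have "x - (\<Sum>b\<in>B. (b \<bullet> x) *\<^sub>R b) \<in> span B" using B(3) by simp
    moreover have "orthogonal (x - (\<Sum>b\<in>B. (b \<bullet> x) *\<^sub>R b)) c" if "c \<in> B" for c
    proof -
      have "c \<bullet> (\<Sum>b\<in>B. (b \<bullet> x) *\<^sub>R b) = (\<Sum>b\<in>B. if b = c then c \<bullet> x else 0)"
        unfolding inner_sum_right by (rule sum.cong) (auto simp: o[OF that])
      also have "\<dots> = c \<bullet> x" using fin that by simp
      finally have "c \<bullet> (x - (\<Sum>b\<in>B. (b \<bullet> x) *\<^sub>R b)) = 0" by (simp only: inner_diff_right)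
      then show ?thesis by (simp only: orthogonal_def inner_commute[of _ c])
    qed
    ultimately have "x - (\<Sum>b\<in>B. (b \<bullet> x) *\<^sub>R b) = 0"
      using orthogonal_to_span[of _ B] orthogonal_self by blast
    then show ?thesis by simp
  qed
  then show ?thesis using that fin o B(2) by blast
qed

text \<open>The root takes square roots of the eigenvalues in an orthonormal eigenbasis.\<close>

lemma psd_operator_sqrt:
  fixes A :: "'a::euclidean_space \<Rightarrow> 'a"
  assumes A: "linear A" and sym: "\<And>x y. A x \<bullet> y = x \<bullet> A y" and psd: "\<And>x. 0 \<le> x \<bullet> A x"
  obtains R where "linear R" "\<And>x y. R x \<bullet> y = x \<bullet> R y" "\<And>x. 0 \<le> x \<bullet> R x" "\<And>x. R (R x) = A x"
proof -
  interpret A: linear A by (rule A)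
  obtain B where B: "finite B" "\<And>b c. b \<in> B \<Longrightarrow> c \<in> B \<Longrightarrow> b \<bullet> c = (if b = c then 1 else 0)"
    "\<And>b. b \<in> B \<Longrightarrow> A b = (b \<bullet> A b) *\<^sub>R b" "\<And>x. x = (\<Sum>b\<in>B. (b \<bullet> x) *\<^sub>R b)"
    by (rule selfadjoint_orthonormal_expansion[OF A sym]) (rule that)
  define r where "r b = sqrt (b \<bullet> A b)" for b
  have rr: "r b * r b = b \<bullet> A b" for b using psd by (simp add: r_def)
  define R where "R x = (\<Sum>b\<in>B. (r b * (b \<bullet> x)) *\<^sub>R b)" for x
  have lin: "linear R"
    by (rule linearI)
      (simp_all add: R_def inner_add_right distrib_left scaleR_add_left sum.distrib scaleR_sum_right mult.left_commute)
  have coord: "c \<bullet> R x = r c * (c \<bullet> x)" if "c \<in> B" for c x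
  proof -
    have "c \<bullet> R x = (\<Sum>b\<in>B. if b = c then r c * (c \<bullet> x) else 0)"
      unfolding R_def inner_sum_right by (rule sum.cong) (auto simp: B(2)[OF that])
    then show ?thesis using B(1) that by simp
  qed
  have form: "y \<bullet> R x = (\<Sum>b\<in>B. r b * (b \<bullet> x) * (b \<bullet> y))" for x y
    unfolding R_def inner_sum_right by (simp add: inner_commute)
  have "R (R x) = A x" for x
  proof -
    have "R (R x) = (\<Sum>b\<in>B. (r b * r b * (b \<bullet> x)) *\<^sub>R b)"
      unfolding R_def[of "R x"] by (rule sum.cong) (auto simp: coord)
    also have "\<dots> = (\<Sum>b\<in>B. (b \<bullet> x) *\<^sub>R A b)"
      by (rule sum.cong) (use B(3) rr in \<open>metis scaleR_scaleR mult.commute\<close>)+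
    also have "\<dots> = A (\<Sum>b\<in>B. (b \<bullet> x) *\<^sub>R b)" by (simp add: A.sum A.scaleR)
    finally show ?thesis using B(4)[of x] by simp
  qed
  moreover have "R x \<bullet> y = x \<bullet> R y" for x y
    unfolding inner_commute[of "R x"] form by (simp add: mult_ac)
  moreover have "0 \<le> x \<bullet> R x" for x
    unfolding form using psd by (intro sum_nonneg) (auto simp: r_def mult.assoc)
  ultimately show ?thesis using that lin by blast
qed

lemma symmetric_matrix_selfadjoint:
  fixes A :: "real^'m^'m"
  assumes "transpose A = A"
  shows "(A *v x) \<bullet> y = x \<bullet> (A *v y)"
  using assms by (metis dot_lmul_matrix inner_commute transpose_matrix_vector)

text \<open>Needed because \<open>min_eigenvalue\<close> is a \<open>Min\<close>, which means something for finite sets only.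
  An eigenvector has a nonzero coordinate along some element of an orthonormal eigenbasis, and so
  shares its eigenvalue.\<close>

lemma finite_eigenvalues_symmetric:
  fixes A :: "real^'m^'m"
  assumes "transpose A = A"
  shows "finite (eigenvalues A)"
proof -
  note sym = symmetric_matrix_selfadjoint[OF assms]
  obtain B where B: "finite B"
    "\<And>b. b \<in> B \<Longrightarrow> A *v b = (b \<bullet> (A *v b)) *\<^sub>R b" "\<And>x. x = (\<Sum>b\<in>B. (b \<bullet> x) *\<^sub>R b)"
    by (rule selfadjoint_orthonormal_expansion[OF matrix_vector_mul_linear[of A] sym]) (rule that)
  have "eigenvalues A \<subseteq> (\<lambda>b. b \<bullet> (A *v b)) ` B"
  proof
    fix l assume "l \<in> eigenvalues A"
    then obtain v where v: "v \<noteq> 0" "A *v v = l *\<^sub>R v" by (auto simp: eigenvalues_def)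
    have "\<exists>b\<in>B. b \<bullet> v \<noteq> 0"
    proof (rule ccontr)
      assume "\<not> (\<exists>b\<in>B. b \<bullet> v \<noteq> 0)"
      then have "(\<Sum>b\<in>B. (b \<bullet> v) *\<^sub>R b) = 0" by (intro sum.neutral) auto
      then show False using B(3)[of v] v(1) by simp
    qed
    then obtain b where b: "b \<in> B" "b \<bullet> v \<noteq> 0" by blast
    have "l * (b \<bullet> v) = (A *v b) \<bullet> v" using sym[of b v] v by simp
    also have "\<dots> = (b \<bullet> (A *v b)) * (b \<bullet> v)" by (subst B(2)[OF b(1)]) simp
    finally show "l \<in> (\<lambda>b. b \<bullet> (A *v b)) ` B" using b by auto
  qed
  then show ?thesis using B(1) finite_surj by blast
qed

lemma rayleigh_le_eigenvalue:
  fixes A :: "real^'m^'m"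
  assumes "transpose A = A"
  obtains l where "l \<in> eigenvalues A" "\<And>x. x \<bullet> (A *v x) \<le> l * (norm x)\<^sup>2"
proof -
  have ne: "(UNIV :: (real^'m) set) \<noteq> {0}"
    using UNIV_I by (metis singletonD zero_neq_one)
  obtain b l where "norm b = 1" "A *v b = l *\<^sub>R b" "\<And>x. x \<bullet> (A *v x) \<le> l * (norm x)\<^sup>2"
    using rayleigh_maximum_is_eigenvector[OF matrix_vector_mul_linear[of A]
        symmetric_matrix_selfadjoint[OF assms] subspace_UNIV _ ne] by auto
  moreover from this have "b \<noteq> 0" by force
  ultimately show ?thesis using that[of l] unfolding eigenvalues_def by blast
qed

lemma min_eigenvalue_le_rayleigh:
  fixes A :: "real^'m^'m"
  assumes "transpose A = A"
  shows "min_eigenvalue A * (norm x)\<^sup>2 \<le> x \<bullet> (A *v x)"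
proof -
  have neg: "(- A) *v y = - (A *v y)" for y
    using matrix_vector_mult_diff_rdistrib[of 0 A y] by simp
  have "transpose (- A) = - A" using assms by (simp add: transpose_def vec_eq_iff)
  then obtain l where l: "l \<in> eigenvalues (- A)" "\<And>x. x \<bullet> ((- A) *v x) \<le> l * (norm x)\<^sup>2"
    using rayleigh_le_eigenvalue by blast
  have "- l \<in> eigenvalues A"
  proof -
    obtain v where v: "v \<noteq> 0" "- (A *v v) = l *\<^sub>R v" using l(1) by (auto simp: eigenvalues_def neg)
    then have "A *v v = (- l) *\<^sub>R v" by (metis minus_minus scaleR_minus_left)
    then show ?thesis using v(1) by (auto simp: eigenvalues_def)
  qed
  then have "min_eigenvalue A \<le> - l"
    unfolding min_eigenvalue_def using finite_eigenvalues_symmetric[OF assms] by simp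
  then have "min_eigenvalue A * (norm x)\<^sup>2 \<le> - l * (norm x)\<^sup>2" by (rule mult_right_mono) simp
  also have "\<dots> \<le> x \<bullet> (A *v x)" using l(2)[of x] by (simp add: neg)
  finally show ?thesis .
qed

lemma psd_sqrt_correct:
  fixes A :: "real^'m^'m"
  assumes "psd A"
  shows "psd (psd_sqrt A)" "psd_sqrt A ** psd_sqrt A = A"
proof -
  have "transpose A = A" "\<And>v. 0 \<le> v \<bullet> (A *v v)" using assms by (auto simp: psd_def)
  then obtain R where R: "linear R" "\<And>x y. R x \<bullet> y = x \<bullet> R y" "\<And>x. 0 \<le> x \<bullet> R x" "\<And>x. R (R x) = A *v x"
    using psd_operator_sqrt[OF matrix_vector_mul_linear[of A] symmetric_matrix_selfadjoint] by metis
  have RR: "matrix R *v x = R x" for x using R(1) by (simp add: matrix_works)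
  have "transpose (matrix R) = matrix R"
    using R(2) by (simp add: transpose_def matrix_def vec_eq_iff)
      (metis cart_eq_inner_axis inner_commute)
  then have "psd (matrix R)" using R(3) by (simp add: psd_def RR)
  moreover have "matrix R ** matrix R = A"
    by (simp add: matrix_eq matrix_vector_mul_assoc[symmetric] RR R(4))
  ultimately have "psd (psd_sqrt A) \<and> psd_sqrt A ** psd_sqrt A = A"
    unfolding psd_sqrt_def by (intro someI[where P="\<lambda>U. psd U \<and> U ** U = A"]) simp
  then show "psd (psd_sqrt A)" "psd_sqrt A ** psd_sqrt A = A" by auto
qed

text \<open>A positive definite form is the standard inner product after a linear change of variables. In this
  way the metric of PG-EXTRA is removed, and the convergence theory can be developed for the
  standard norm.\<close>

lemma positive_definite_isometry:
  fixes A :: "'a::euclidean_space \<Rightarrow> 'a"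
  assumes A: "linear A" and sym: "\<And>x y. A x \<bullet> y = x \<bullet> A y" and pos: "\<And>x. x \<noteq> 0 \<Longrightarrow> 0 < x \<bullet> A x"
  obtains L L' :: "'a \<Rightarrow> 'a" where "linear L" "linear L'" "\<And>x. L' (L x) = x" "\<And>x. L (L' x) = x"
    "\<And>x y. L x \<bullet> L y = x \<bullet> A y"
proof -
  interpret A: linear A by (rule A)
  have "0 \<le> x \<bullet> A x" for x using pos[of x] by (cases "x = 0") (auto simp: A.zero)
  then obtain L where L: "linear L" "\<And>x y. L x \<bullet> y = x \<bullet> L y" "\<And>x. L (L x) = A x"
    using psd_operator_sqrt[OF A sym] by metis
  have form: "L x \<bullet> L y = x \<bullet> A y" for x y using L(2)[of x "L y"] L(3) by simp
  have "L x = 0 \<Longrightarrow> x = 0" for x using form[of x x] pos[of x] by fastforce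
  then have "inj L" using L(1) by (simp add: linear_injective_0)
  then obtain L' where "linear L'" "\<forall>x. L' (L x) = x" "\<forall>x. L (L' x) = x"
    using linear_injective_isomorphism[OF L(1)] by blast
  then show ?thesis by (intro that[of L L']) (auto simp: L(1) form)
qed

text \<open>The Frobenius inner product is a sum over columns, and left multiplication by a matrix acts on
  each column separately. Spectral facts about vectors therefore carry over to matrices with \<open>d\<close>
  columns.\<close>

lemma inner_eq_sum_columns:
  fixes x y :: "real^'d^'m"
  shows "x \<bullet> y = (\<Sum>k\<in>UNIV. column k x \<bullet> column k y)"
  unfolding inner_vec_def column_def by (simp add: sum.swap[of _ "UNIV :: 'd set"])

lemma column_matrix_mult: "column k (A ** x) = A *v column k x"
  by (simp add: vec_eq_iff column_def matrix_matrix_mult_def matrix_vector_mult_def)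

lemma linear_matrix_mult_left: "linear (\<lambda>x :: real^'d^'m. (A :: real^'m^'n) ** x)"
  by (rule linearI)
    (simp_all add: vec_eq_iff matrix_matrix_mult_def sum.distrib distrib_left sum_distrib_left mult_ac)

lemma symmetric_matrix_mult_selfadjoint:
  fixes x y :: "real^'d^'m"
  assumes "transpose A = A"
  shows "(A ** x) \<bullet> y = x \<bullet> (A ** y)"
  unfolding inner_eq_sum_columns column_matrix_mult
  by (simp add: symmetric_matrix_selfadjoint[OF assms])

lemma min_eigenvalue_le_rayleigh_columns:
  fixes x :: "real^'d^'m"
  assumes "transpose A = A"
  shows "min_eigenvalue A * (norm x)\<^sup>2 \<le> x \<bullet> (A ** x)"
  unfolding power2_norm_eq_inner inner_eq_sum_columns[of x] column_matrix_mult sum_distrib_left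
  by (intro sum_mono) (use min_eigenvalue_le_rayleigh[OF assms] in \<open>simp add: power2_norm_eq_inner\<close>)

lemma trace_transpose_mult_eq_inner:
  fixes x y :: "real^'d^'m"
  shows "trace (transpose x ** y) = x \<bullet> y"
  unfolding inner_eq_sum_columns
  by (simp add: trace_def transpose_def matrix_matrix_mult_def column_def inner_vec_def)

section \<open>The proximal operator\<close>

text \<open>Separate a point strictly below the graph from the closed convex epigraph.\<close>

lemma closed_convex_affine_minorant:
  fixes f :: "'a::euclidean_space \<Rightarrow> ereal"
  assumes cl: "closed_fun f" and cv: "convex_fun f" and pr: "proper_fun f"
  obtains a c where "\<And>x t. f x \<le> ereal t \<Longrightarrow> c + a \<bullet> x \<le> t"
proof -
  let ?E = "{(x, t::real). f x \<le> ereal t}"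
  obtain x0 t0 where x0: "f x0 = ereal t0" using pr unfolding proper_fun_def by (metis real_of_ereal.cases)
  have "(x0, t0 - 1) \<notin> ?E" using x0 by simp
  then obtain n b where n: "n \<bullet> (x0, t0 - 1) < b" "\<And>z. z \<in> ?E \<Longrightarrow> b < n \<bullet> z"
    using separating_hyperplane_closed_point[of ?E "(x0, t0 - 1)"] cl cv
    by (auto simp: closed_fun_def convex_fun_def)
  obtain p q where pq: "n = (p, q)" by force
  \<comment> \<open>The point directly above \<open>(x0, t0 - 1)\<close> lies on the other side, so the hyperplane is not vertical.\<close>
  have "q > 0" using n(1) n(2)[of "(x0, t0)"] x0 by (simp add: pq algebra_simps)
  have "b / q + (- (1 / q) *\<^sub>R p) \<bullet> x \<le> t" if "f x \<le> ereal t" for x t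
    using n(2)[of "(x, t)"] that \<open>q > 0\<close> by (simp add: pq field_simps)
  then show ?thesis using that by blast
qed

text \<open>The affine minorant makes the objective coercive, so its sublevel sets in the epigraph are compact.
  Minimising over the epigraph instead of the domain replaces the extended-valued \<open>f\<close> by a
  continuous function.\<close>

lemma prox_minimizer_exists:
  fixes f :: "'a::euclidean_space \<Rightarrow> ereal"
  assumes cl: "closed_fun f" and cv: "convex_fun f" and pr: "proper_fun f" and \<tau>: "\<tau> > 0"
  obtains p t where "f p = ereal t"
    "\<And>x s. f x \<le> ereal s \<Longrightarrow> \<tau> * t + 1/2 * (norm (p - y))\<^sup>2 \<le> \<tau> * s + 1/2 * (norm (x - y))\<^sup>2"
proof -
  let ?E = "{(x, t::real). f x \<le> ereal t}"
  let ?g = "\<lambda>z::'a \<times> real. \<tau> * snd z + 1/2 * (norm (fst z - y))\<^sup>2"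
  obtain a c where ac: "\<And>x t. f x \<le> ereal t \<Longrightarrow> c + a \<bullet> x \<le> t"
    using closed_convex_affine_minorant[OF cl cv pr] by metis
  obtain x0 t0 where x0: "f x0 = ereal t0" using pr unfolding proper_fun_def by (metis real_of_ereal.cases)
  define G where "G = ?g (x0, t0)"
  define K where "K = {z \<in> ?E. ?g z \<le> G}"
  define b where "b = y - \<tau> *\<^sub>R a"
  define r where "r = 2 * (G - \<tau> * c - \<tau> * (a \<bullet> y) + 1/2 * (\<tau>\<^sup>2 * (norm a)\<^sup>2))"
  \<comment> \<open>Completing the square in the affine minorant plus the quadratic bounds the first coordinate.\<close>
  have sq: "(norm (x - b))\<^sup>2 \<le> r" if "(x, t) \<in> K" for x t
  proof -
    have "\<tau> * (c + a \<bullet> x) \<le> \<tau> * t" using that ac \<tau> by (auto simp: K_def intro!: mult_left_mono)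
    moreover have "\<tau> * t + 1/2 * (norm (x - y))\<^sup>2 \<le> G" using that by (simp add: K_def)
    moreover have "(norm (x - b))\<^sup>2 = (norm (x - y))\<^sup>2 + 2 * \<tau> * (a \<bullet> x - a \<bullet> y) + \<tau>\<^sup>2 * (norm a)\<^sup>2"
      unfolding b_def power2_norm_eq_inner
      by (simp add: inner_diff_left inner_diff_right inner_add_left inner_add_right algebra_simps inner_commute power2_eq_square)
    ultimately show ?thesis unfolding r_def by (simp add: algebra_simps)
  qed
  have bnd: "bounded K"
  proof -
    define R where "R = norm b + sqrt r"
    define Q where "Q = max (\<bar>c\<bar> + norm a * R) (\<bar>G\<bar> / \<tau>)"
    have "norm x \<le> R \<and> \<bar>t\<bar> \<le> Q" if z: "(x, t) \<in> K" for x t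
    proof
      have "norm (x - b) \<le> sqrt r" using sq[OF z] real_le_rsqrt by blast
      then show R: "norm x \<le> R" unfolding R_def using norm_triangle_ineq2[of x b] by linarith
      have "- (norm a * norm x) \<le> a \<bullet> x" using Cauchy_Schwarz_ineq2[of a x] by linarith
      moreover have "norm a * norm x \<le> norm a * R" using R by (simp add: mult_left_mono)
      moreover have "c + a \<bullet> x \<le> t" using z ac by (auto simp: K_def)
      ultimately have "- (\<bar>c\<bar> + norm a * R) \<le> t" by linarith
      moreover have "\<tau> * t \<le> \<bar>G\<bar>"
      proof -
        have "\<tau> * t + 1/2 * (norm (x - y))\<^sup>2 \<le> G" using z by (simp add: K_def)
        moreover have "0 \<le> 1/2 * (norm (x - y))\<^sup>2" by simp
        ultimately show ?thesis by linarith
      qed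
      then have "t \<le> \<bar>G\<bar> / \<tau>" using \<tau> by (simp add: field_simps)
      ultimately show "\<bar>t\<bar> \<le> Q" unfolding Q_def by linarith
    qed
    then have "K \<subseteq> cball 0 R \<times> cball 0 Q" by auto
    then show ?thesis using bounded_Times bounded_cball bounded_subset by metis
  qed
  have "K = ?E \<inter> {z. ?g z \<le> G}" unfolding K_def by blast
  moreover have "closed {z. ?g z \<le> G}" by (intro closed_Collect_le continuous_intros)
  ultimately have "closed K" using cl by (auto simp: closed_fun_def)
  then have "compact K" using bnd compact_eq_bounded_closed by blast
  moreover have xK: "(x0, t0) \<in> K" using x0 by (simp add: K_def G_def)
  moreover have "continuous_on K ?g" by (intro continuous_intros)
  ultimately obtain z where zK: "z \<in> K" and zmin: "\<And>w. w \<in> K \<Longrightarrow> ?g z \<le> ?g w"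
    using continuous_attains_inf[of K ?g] by blast
  obtain p s where ps: "z = (p, s)" by force
  have fp: "f p \<le> ereal s" using zK by (simp add: K_def ps)
  then obtain t where t: "f p = ereal t" using pr unfolding proper_fun_def
    by (metis MInfty_neq_ereal(1) ereal_infty_less_eq(1) real_of_ereal.cases)
  have min: "\<tau> * t + 1/2 * (norm (p - y))\<^sup>2 \<le> \<tau> * s' + 1/2 * (norm (x - y))\<^sup>2" if x: "f x \<le> ereal s'" for x s'
  proof -
    have "\<tau> * t \<le> \<tau> * s" using fp t \<tau> by simp
    then have "?g (p, t) \<le> ?g z" by (simp add: ps)
    moreover have "?g z \<le> ?g (x, s')"
    proof (cases "(x, s') \<in> K")
      case False
      then have "?g (x, s') > G" using x by (simp add: K_def)
      then show ?thesis using zmin[OF xK] by (simp add: G_def)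
    qed (use zmin in blast)
    ultimately show ?thesis by simp
  qed
  show ?thesis using that[OF t min] by blast
qed

lemma prox_is_minimizer:
  fixes f :: "'a::euclidean_space \<Rightarrow> ereal"
  assumes "closed_fun f" "convex_fun f" and pr: "proper_fun f" and \<tau>: "\<tau> > 0"
  obtains t where "f (prox \<tau> f y) = ereal t"
    "\<And>x s. f x \<le> ereal s \<Longrightarrow>
       \<tau> * t + 1/2 * (norm (prox \<tau> f y - y))\<^sup>2 \<le> \<tau> * s + 1/2 * (norm (x - y))\<^sup>2"
proof -
  define g where "g x = ereal \<tau> * f x + ereal (1 / 2 * (norm (x - y))\<^sup>2)" for x
  have val: "g x = ereal (\<tau> * s + 1/2 * (norm (x - y))\<^sup>2)" if "f x = ereal s" for x s
    using that by (simp add: g_def)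
  have inf: "g x = \<infinity>" if "f x = \<infinity>" for x using that \<tau> by (simp add: g_def)
  obtain p t where p: "f p = ereal t"
    "\<And>x s. f x \<le> ereal s \<Longrightarrow> \<tau> * t + 1/2 * (norm (p - y))\<^sup>2 \<le> \<tau> * s + 1/2 * (norm (x - y))\<^sup>2"
    using prox_minimizer_exists[OF assms] by metis
  have fin: "f x = \<infinity> \<or> (\<exists>s. f x = ereal s)" for x using pr unfolding proper_fun_def by (metis real_of_ereal.cases)
  have "g p \<le> g x" for x
    using fin[of x] p(2)[of x] by (auto simp: val inf val[OF p(1)])
  then have "is_arg_min g (\<lambda>x. True) p" by (auto simp: is_arg_min_def not_less)
  then have "is_arg_min g (\<lambda>x. True) (prox \<tau> f y)"
    unfolding prox_def arg_min_def g_def by (rule someI)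
  then have min: "g (prox \<tau> f y) \<le> g x" for x by (auto simp: is_arg_min_def not_less)
  obtain t' where t': "f (prox \<tau> f y) = ereal t'"
    using min[of p] fin[of "prox \<tau> f y"] inf val[OF p(1)] by fastforce
  have "\<tau> * t' + 1/2 * (norm (prox \<tau> f y - y))\<^sup>2 \<le> \<tau> * s + 1/2 * (norm (x - y))\<^sup>2" if "f x \<le> ereal s" for x s
    using min[of p] p(2)[OF that] by (simp add: val[OF t'] val[OF p(1)])
  then show ?thesis using that t' by blast
qed

text \<open>This says that \<open>(y - prox \<tau> f y) / \<tau>\<close> is a subgradient of \<open>f\<close> at \<open>prox \<tau> f y\<close>. It is obtained
  by comparing the minimiser with points on the segment to \<open>x\<close> and letting the step \<open>h\<close> go to 0.\<close>

lemma prox_variational_inequality: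
  fixes f :: "'a::euclidean_space \<Rightarrow> ereal"
  assumes "closed_fun f" and cv: "convex_fun f" and "proper_fun f" and \<tau>: "\<tau> > 0"
  obtains t where "f (prox \<tau> f y) = ereal t"
    "\<And>x s. f x \<le> ereal s \<Longrightarrow> (y - prox \<tau> f y) \<bullet> (x - prox \<tau> f y) \<le> \<tau> * (s - t)"
proof -
  define p where "p = prox \<tau> f y"
  obtain t where t: "f p = ereal t"
    "\<And>x s. f x \<le> ereal s \<Longrightarrow> \<tau> * t + 1/2 * (norm (p - y))\<^sup>2 \<le> \<tau> * s + 1/2 * (norm (x - y))\<^sup>2"
    unfolding p_def using prox_is_minimizer[OF assms] by metis
  have "(y - p) \<bullet> (x - p) \<le> \<tau> * (s - t)" if xs: "f x \<le> ereal s" for x s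
  proof (rule field_le_epsilon)
    fix e :: real assume e: "e > 0"
    \<comment> \<open>A step so short that the quadratic error \<open>h \<bar>x - p\<bar>\<^sup>2 / 2\<close> is at most \<open>e\<close>.\<close>
    define h where "h = min 1 (2 * e / ((norm (x - p))\<^sup>2 + 1))"
    have npos: "(norm (x - p))\<^sup>2 + 1 > 0" by (smt (verit) zero_le_power2)
    have h: "0 < h" "h \<le> 1" using e npos by (auto simp: h_def)
    have "h * (norm (x - p))\<^sup>2 \<le> (2 * e / ((norm (x - p))\<^sup>2 + 1)) * ((norm (x - p))\<^sup>2 + 1)"
      using h e npos by (intro mult_mono) (auto simp: h_def)
    then have he: "h * (norm (x - p))\<^sup>2 \<le> 2 * e" using npos by simp
    have "(1 - h) *\<^sub>R (p, t) + h *\<^sub>R (x, s) \<in> {(x, t::real). f x \<le> ereal t}"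
      using cv xs t(1) h by (intro convexD_alt) (auto simp: convex_fun_def)
    then have "f ((1 - h) *\<^sub>R p + h *\<^sub>R x) \<le> ereal ((1 - h) * t + h * s)" by simp
    from t(2)[OF this] have "(norm (p - y))\<^sup>2 \<le> 2 * \<tau> * h * (s - t) + (norm ((1 - h) *\<^sub>R p + h *\<^sub>R x - y))\<^sup>2"
      by (simp add: algebra_simps)
    also have "(1 - h) *\<^sub>R p + h *\<^sub>R x - y = (p - y) + h *\<^sub>R (x - p)" by (simp add: algebra_simps)
    also have "(norm \<dots>)\<^sup>2 = (norm (p - y))\<^sup>2 + 2 * h * ((p - y) \<bullet> (x - p)) + h\<^sup>2 * (norm (x - p))\<^sup>2"
      unfolding power2_norm_eq_inner by (simp add: inner_add_left inner_add_right inner_commute power2_eq_square algebra_simps)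
    finally have "0 \<le> h * (2 * \<tau> * (s - t) + 2 * ((p - y) \<bullet> (x - p)) + h * (norm (x - p))\<^sup>2)"
      by (simp add: algebra_simps power2_eq_square)
    then have "0 \<le> 2 * \<tau> * (s - t) + 2 * ((p - y) \<bullet> (x - p)) + h * (norm (x - p))\<^sup>2"
      using h by (simp add: zero_le_mult_iff)
    moreover have "(p - y) \<bullet> (x - p) = - ((y - p) \<bullet> (x - p))" by (simp add: inner_diff_left)
    ultimately show "(y - p) \<bullet> (x - p) \<le> \<tau> * (s - t) + e" using he by simp
  qed
  then show ?thesis using that t(1) unfolding p_def by blast
qed

text \<open>Add the two variational inequalities, each tested at the other proximal point: the function
  values cancel.\<close>

lemma prox_firmly_nonexpansive:
  fixes f :: "'a::euclidean_space \<Rightarrow> ereal"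
  assumes "closed_fun f" "convex_fun f" "proper_fun f" "\<tau> > 0"
  shows "(norm (prox \<tau> f y - prox \<tau> f z))\<^sup>2 \<le> (y - z) \<bullet> (prox \<tau> f y - prox \<tau> f z)"
proof -
  obtain s where s: "f (prox \<tau> f y) = ereal s"
    "\<And>x r. f x \<le> ereal r \<Longrightarrow> (y - prox \<tau> f y) \<bullet> (x - prox \<tau> f y) \<le> \<tau> * (r - s)"
    using prox_variational_inequality[OF assms] by metis
  obtain t where t: "f (prox \<tau> f z) = ereal t"
    "\<And>x r. f x \<le> ereal r \<Longrightarrow> (z - prox \<tau> f z) \<bullet> (x - prox \<tau> f z) \<le> \<tau> * (r - t)"
    using prox_variational_inequality[OF assms] by metis
  have "(y - prox \<tau> f y) \<bullet> (prox \<tau> f z - prox \<tau> f y) \<le> \<tau> * (t - s)" using s(2)[of "prox \<tau> f z" t] t(1) by simp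
  moreover have "(z - prox \<tau> f z) \<bullet> (prox \<tau> f y - prox \<tau> f z) \<le> \<tau> * (s - t)" using t(2)[of "prox \<tau> f y" s] s(1) by simp
  ultimately show ?thesis
    unfolding power2_norm_eq_inner by (simp add: inner_diff_left inner_diff_right inner_commute algebra_simps)
qed

lemma prox_rows_firmly_nonexpansive:
  fixes f :: "'m::finite \<Rightarrow> real^'d \<Rightarrow> ereal"
  assumes "\<And>i. closed_fun (f i)" "\<And>i. convex_fun (f i)" "\<And>i. proper_fun (f i)" "\<tau> > 0"
  shows "(norm (prox_rows \<tau> f y - prox_rows \<tau> f z))\<^sup>2 \<le> (y - z) \<bullet> (prox_rows \<tau> f y - prox_rows \<tau> f z)"
  unfolding power2_norm_eq_inner inner_vec_def[of "_ :: real^'d^'m"]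
  by (intro sum_mono)
    (use prox_firmly_nonexpansive[OF assms] in \<open>simp add: prox_rows_def power2_norm_eq_inner\<close>)

section \<open>Orbits of relaxed firmly nonexpansive maps\<close>

text \<open>Throughout, \<open>S\<close> stands for the displacement \<open>Id - T\<close> of a firmly nonexpansive \<open>T\<close>. In terms of
  \<open>S\<close>, firm nonexpansiveness of \<open>T\<close> is the cocoercivity inequality assumed in these lemmas; it makes
  \<open>S\<close> firmly nonexpansive as well, and monotone.\<close>

lemma firm_displacement_lipschitz:
  fixes S :: "'a::real_inner \<Rightarrow> 'a"
  assumes firm: "\<And>x y. (norm (S x - S y))\<^sup>2 \<le> (S x - S y) \<bullet> (x - y)"
  shows "norm (S x - S y) \<le> norm (x - y)"
proof (cases "S x = S y")
  case False
  have "(norm (S x - S y))\<^sup>2 \<le> norm (S x - S y) * norm (x - y)"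
    using firm[of x y] norm_cauchy_schwarz[of "S x - S y" "x - y"] by linarith
  then show ?thesis using False by (simp add: power2_eq_square)
qed simp

lemma firm_displacement_resolvent:
  fixes S :: "'a::euclidean_space \<Rightarrow> 'a"
  assumes firm: "\<And>x y. (norm (S x - S y))\<^sup>2 \<le> (S x - S y) \<bullet> (x - y)" and t: "t > 0"
  obtains z where "t *\<^sub>R z + S z = 0"
proof -
  have nonexp: "norm ((x - S x) - (y - S y)) \<le> norm (x - y)" for x y
  proof -
    have "(norm ((x - S x) - (y - S y)))\<^sup>2 = (norm (x - y))\<^sup>2 - 2 * ((S x - S y) \<bullet> (x - y)) + (norm (S x - S y))\<^sup>2"
      unfolding power2_norm_eq_inner by (simp add: inner_diff_left inner_diff_right inner_commute algebra_simps)
    then have "(norm ((x - S x) - (y - S y)))\<^sup>2 \<le> (norm (x - y))\<^sup>2"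
      using firm[of x y] zero_le_power2[of "norm (S x - S y)"] by linarith
    then show ?thesis by (rule power2_le_imp_le) simp
  qed
  \<comment> \<open>A root of \<open>t z + S z\<close> is a fixed point of the contraction \<open>z \<mapsto> (z - S z) / (1 + t)\<close>.\<close>
  let ?g = "\<lambda>z. (1 / (1 + t)) *\<^sub>R (z - S z)"
  have "dist (?g x) (?g y) \<le> (1 / (1 + t)) * dist x y" for x y
  proof -
    have "dist (?g x) (?g y) = (1 / (1 + t)) * norm ((x - S x) - (y - S y))"
      unfolding dist_norm scaleR_diff_right[symmetric] norm_scaleR using t by simp
    also have "\<dots> \<le> (1 / (1 + t)) * dist x y"
      unfolding dist_norm using t nonexp by (intro mult_left_mono) auto
    finally show ?thesis .
  qed
  then have "\<exists>!z. ?g z = z" using t by (intro banach_fix_type[of "1 / (1 + t)"]) auto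
  then obtain z where z: "?g z = z" by blast
  have "z - S z = (1 + t) *\<^sub>R z" using t by (subst (3) z[symmetric]) simp
  then show ?thesis using that[of z] by (simp add: algebra_simps)
qed

text \<open>For the least element of a closed convex set this is the projection inequality. It holds for the
  range of \<open>S\<close> without a proof that its closure is convex: let \<open>z t\<close> solve \<open>t z + S z = 0\<close>.
  Monotonicity of \<open>S\<close> between \<open>y\<close> and \<open>z t\<close> shows that \<open>S (z t)\<close> stays bounded and that every limit
  point \<open>q\<close> as \<open>t \<rightarrow> 0\<close> satisfies the inequality in place of \<open>v\<close>. By continuity \<open>S y\<close> may
  be replaced by \<open>v\<close> there, and minimality of \<open>v\<close> then gives \<open>v = q\<close>.\<close>

lemma min_displacement_variational_inequality:
  fixes S :: "'a::euclidean_space \<Rightarrow> 'a"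
  assumes firm: "\<And>x y. (norm (S x - S y))\<^sup>2 \<le> (S x - S y) \<bullet> (x - y)"
    and v: "v \<in> closure (range S)" "\<And>q. q \<in> closure (range S) \<Longrightarrow> norm v \<le> norm q"
  shows "(norm v)\<^sup>2 \<le> S y \<bullet> v"
proof -
  define t where "t n = 1 / real (Suc n)" for n
  have t0: "t n > 0" for n by (simp add: t_def)
  have "\<forall>n. \<exists>z. t n *\<^sub>R z + S z = 0" using firm_displacement_resolvent[OF firm t0] by metis
  then obtain z where z: "\<And>n. t n *\<^sub>R z n + S (z n) = 0" by metis
  define p where "p n = S (z n)" for n
  have pz: "p n = - (t n *\<^sub>R z n)" for n
    using z[of n] unfolding p_def by (simp add: add_eq_0_iff)
  have mono: "0 \<le> t n * ((S y - p n) \<bullet> y) + (S y - p n) \<bullet> p n" for y n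
  proof -
    have "0 \<le> t n * ((S y - p n) \<bullet> (y - z n))"
      using order_trans[OF zero_le_power2 firm[of y "z n"]] t0[of n] by (simp add: p_def)
    also have "\<dots> = t n * ((S y - p n) \<bullet> y) + (S y - p n) \<bullet> p n"
      by (subst (3) pz) (simp add: inner_diff_right algebra_simps)
    finally show ?thesis .
  qed
  have "norm (p n) \<le> norm (S 0)" for n
  proof (cases "p n = 0")
    case False
    have "norm (p n) * norm (p n) \<le> S 0 \<bullet> p n"
      using mono[of n 0] by (simp add: inner_diff_left dot_square_norm power2_eq_square)
    also have "\<dots> \<le> norm (S 0) * norm (p n)" by (rule norm_cauchy_schwarz)
    finally show ?thesis using False by simp
  qed simp
  then have "bounded (range p)" by (auto simp: bounded_iff)
  then obtain q r where r: "strict_mono r" and lim: "(p \<circ> r) \<longlonglongrightarrow> q"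
    using bounded_imp_convergent_subsequence by blast
  have q: "q \<in> closure (range S)"
    using lim by (auto simp: closure_sequential p_def intro!: exI[of _ "p \<circ> r"])
  have tl: "(t \<circ> r) \<longlonglongrightarrow> 0" unfolding t_def
    by (rule LIMSEQ_subseq_LIMSEQ[OF LIMSEQ_Suc[OF lim_1_over_n] r])
  have ineq: "(norm q)\<^sup>2 \<le> S y \<bullet> q" for y
  proof -
    have "(\<lambda>n. (t \<circ> r) n * ((S y - (p \<circ> r) n) \<bullet> y) + (S y - (p \<circ> r) n) \<bullet> (p \<circ> r) n)
            \<longlonglongrightarrow> 0 * ((S y - q) \<bullet> y) + (S y - q) \<bullet> q"
      by (intro tendsto_intros lim tl)
    then have "0 \<le> 0 * ((S y - q) \<bullet> y) + (S y - q) \<bullet> q"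
      by (rule LIMSEQ_le_const) (use mono in auto)
    then show ?thesis by (simp add: inner_diff_left dot_square_norm)
  qed
  have "closure (range S) \<subseteq> {x. (norm q)\<^sup>2 \<le> q \<bullet> x}"
    using ineq by (intro closure_minimal closed_halfspace_ge) (auto simp: inner_commute)
  then have vq: "(norm q)\<^sup>2 \<le> q \<bullet> v" using v(1) by blast
  have "(norm (v - q))\<^sup>2 = (norm v)\<^sup>2 - 2 * (q \<bullet> v) + (norm q)\<^sup>2"
    unfolding power2_norm_eq_inner by (simp add: inner_diff_left inner_diff_right inner_commute)
  also have "\<dots> \<le> 0" using vq power_mono[OF v(2)[OF q] norm_ge_zero, of 2] by linarith
  finally have "v = q" by simp
  then show ?thesis using ineq by simp
qed

primrec relaxed_orbit :: "real \<Rightarrow> ('a::real_vector \<Rightarrow> 'a) \<Rightarrow> 'a \<Rightarrow> nat \<Rightarrow> 'a" where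
  "relaxed_orbit \<alpha> S x 0 = x"
| "relaxed_orbit \<alpha> S x (Suc k) = relaxed_orbit \<alpha> S x k - \<alpha> *\<^sub>R S (relaxed_orbit \<alpha> S x k)"

lemma relaxed_step_nonexpansive:
  fixes S :: "'a::real_inner \<Rightarrow> 'a"
  assumes firm: "\<And>x y. (norm (S x - S y))\<^sup>2 \<le> (S x - S y) \<bullet> (x - y)" and \<alpha>: "0 < \<alpha>" "\<alpha> \<le> 1"
  shows "norm ((x - \<alpha> *\<^sub>R S x) - (y - \<alpha> *\<^sub>R S y)) \<le> norm (x - y)"
proof -
  have "(norm ((x - \<alpha> *\<^sub>R S x) - (y - \<alpha> *\<^sub>R S y)))\<^sup>2
      = (norm (x - y))\<^sup>2 - 2 * \<alpha> * ((S x - S y) \<bullet> (x - y)) + \<alpha>\<^sup>2 * (norm (S x - S y))\<^sup>2"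
    unfolding power2_norm_eq_inner
    by (simp add: inner_diff_left inner_diff_right inner_commute algebra_simps power2_eq_square)
  moreover have "\<alpha> * (norm (S x - S y))\<^sup>2 \<le> \<alpha> * ((S x - S y) \<bullet> (x - y))"
    using firm \<alpha> by simp
  moreover have "\<alpha>\<^sup>2 * (norm (S x - S y))\<^sup>2 \<le> \<alpha> * (norm (S x - S y))\<^sup>2"
    using \<alpha> by (intro mult_right_mono) (auto simp: power2_eq_square mult_left_le)
  moreover have "0 \<le> \<alpha> * (norm (S x - S y))\<^sup>2" using \<alpha> by simp
  ultimately have "(norm ((x - \<alpha> *\<^sub>R S x) - (y - \<alpha> *\<^sub>R S y)))\<^sup>2 \<le> (norm (x - y))\<^sup>2" by linarith
  then show ?thesis by (rule power2_le_imp_le) simp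
qed

lemma relaxed_orbit_nonexpansive:
  fixes S :: "'a::real_inner \<Rightarrow> 'a"
  assumes firm: "\<And>x y. (norm (S x - S y))\<^sup>2 \<le> (S x - S y) \<bullet> (x - y)" and \<alpha>: "0 < \<alpha>" "\<alpha> \<le> 1"
  shows "norm (relaxed_orbit \<alpha> S x k - relaxed_orbit \<alpha> S y k) \<le> norm (x - y)"
proof (induction k)
  case (Suc k)
  show ?case using relaxed_step_nonexpansive[OF firm \<alpha>, of "relaxed_orbit \<alpha> S x k" "relaxed_orbit \<alpha> S y k"] Suc
    by simp
qed simp

text \<open>Consecutive points of the orbit do not move apart, because the shifted orbit is also an orbit.\<close>

lemma relaxed_orbit_displacement_bound:
  fixes S :: "'a::real_inner \<Rightarrow> 'a"
  assumes firm: "\<And>x y. (norm (S x - S y))\<^sup>2 \<le> (S x - S y) \<bullet> (x - y)" and \<alpha>: "0 < \<alpha>" "\<alpha> \<le> 1"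
  shows "norm (S (relaxed_orbit \<alpha> S x k)) \<le> norm (S x)"
proof -
  have shift: "relaxed_orbit \<alpha> S x (Suc k) = relaxed_orbit \<alpha> S (x - \<alpha> *\<^sub>R S x) k" for k
    by (induction k) auto
  have "norm (relaxed_orbit \<alpha> S x (Suc k) - relaxed_orbit \<alpha> S x k) \<le> norm ((x - \<alpha> *\<^sub>R S x) - x)"
    unfolding shift by (rule relaxed_orbit_nonexpansive[OF firm \<alpha>])
  then have "\<alpha> * norm (S (relaxed_orbit \<alpha> S x k)) \<le> \<alpha> * norm (S x)" using \<alpha> by simp
  then show ?thesis using \<alpha> by simp
qed

lemma relaxed_orbit_growth:
  fixes S :: "'a::real_inner \<Rightarrow> 'a"
  assumes firm: "\<And>x y. (norm (S x - S y))\<^sup>2 \<le> (S x - S y) \<bullet> (x - y)" and \<alpha>: "0 < \<alpha>" "\<alpha> \<le> 1"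
  shows "norm (relaxed_orbit \<alpha> S x k - x) \<le> \<alpha> * real k * norm (S x)"
proof (induction k)
  case (Suc k)
  let ?y = "relaxed_orbit \<alpha> S x k"
  have "norm (relaxed_orbit \<alpha> S x (Suc k) - x) = norm ((?y - x) - \<alpha> *\<^sub>R S ?y)" by (simp add: algebra_simps)
  also have "\<dots> \<le> norm (?y - x) + norm (\<alpha> *\<^sub>R S ?y)" by (rule norm_triangle_ineq4)
  also have "\<dots> \<le> \<alpha> * real k * norm (S x) + \<alpha> * norm (S x)"
    using Suc relaxed_orbit_displacement_bound[OF firm \<alpha>, of x k] \<alpha> by (simp add: add_mono)
  finally show ?case by (simp add: algebra_simps)
qed simp

text \<open>Pazy's theorem. The variational inequality says that each step increases the
  inner product with \<open>-v\<close> by at least \<open>\<alpha> \<bar>v\<bar>\<^sup>2\<close>. On the other hand all orbits stay within bounded distance of each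
  other, and an orbit started where the displacement is nearly minimal has speed nearly \<open>\<alpha> \<bar>v\<bar>\<close>. A vector
  of length at most \<open>\<alpha> \<bar>v\<bar>\<close> with inner product at most \<open>-\<alpha> \<bar>v\<bar>\<^sup>2\<close> with \<open>v\<close> is \<open>-\<alpha> v\<close>.\<close>

lemma relaxed_orbit_average_tendsto:
  fixes S :: "'a::euclidean_space \<Rightarrow> 'a"
  assumes firm: "\<And>x y. (norm (S x - S y))\<^sup>2 \<le> (S x - S y) \<bullet> (x - y)" and \<alpha>: "0 < \<alpha>" "\<alpha> \<le> 1"
    and v: "v \<in> closure (range S)" "\<And>q. q \<in> closure (range S) \<Longrightarrow> norm v \<le> norm q"
  shows "(\<lambda>k. (1 / real k) *\<^sub>R relaxed_orbit \<alpha> S 0 k) \<longlonglongrightarrow> - \<alpha> *\<^sub>R v"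
proof -
  let ?y = "relaxed_orbit \<alpha> S 0"
  have dir: "?y k \<bullet> v \<le> - (\<alpha> * real k * (norm v)\<^sup>2)" for k
  proof (induction k)
    case (Suc k)
    have "\<alpha> * (norm v)\<^sup>2 \<le> \<alpha> * (S (?y k) \<bullet> v)"
      using min_displacement_variational_inequality[OF firm v, of "?y k"] \<alpha> by simp
    then show ?case using Suc by (simp add: inner_diff_left algebra_simps)
  qed simp
  have upper: "norm (?y k) \<le> 2 * norm q + \<alpha> * real k * norm (S q)" for k q
  proof -
    have "norm (?y k) \<le> norm (?y k - relaxed_orbit \<alpha> S q k) + norm (relaxed_orbit \<alpha> S q k - q) + norm q"
      using norm_triangle_ineq[of "?y k - relaxed_orbit \<alpha> S q k" "relaxed_orbit \<alpha> S q k - q"]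
        norm_triangle_ineq[of "?y k - q" q] by simp
    then show ?thesis
      using relaxed_orbit_nonexpansive[OF firm \<alpha>, of 0 k q] relaxed_orbit_growth[OF firm \<alpha>, of q k] by simp
  qed
  have dist2: "(norm ((1 / real k) *\<^sub>R ?y k + \<alpha> *\<^sub>R v))\<^sup>2 \<le> (norm (?y k) / real k)\<^sup>2 - \<alpha>\<^sup>2 * (norm v)\<^sup>2"
    if k: "k > 0" for k
  proof -
    have "(norm ((1 / real k) *\<^sub>R ?y k + \<alpha> *\<^sub>R v))\<^sup>2
        = (norm (?y k) / real k)\<^sup>2 + 2 * \<alpha> * ((?y k \<bullet> v) / real k) + \<alpha>\<^sup>2 * (norm v)\<^sup>2"
      unfolding power_divide power2_norm_eq_inner
      by (simp add: inner_add_left inner_add_right inner_commute algebra_simps power2_eq_square)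
    moreover have "(?y k \<bullet> v) / real k \<le> - (\<alpha> * (norm v)\<^sup>2)"
      using dir[of k] k by (simp add: field_simps)
    then have "2 * \<alpha> * ((?y k \<bullet> v) / real k) \<le> 2 * \<alpha> * (- (\<alpha> * (norm v)\<^sup>2))"
      using \<alpha> by (intro mult_left_mono) auto
    ultimately show ?thesis by (simp add: power2_eq_square)
  qed
  have "(\<lambda>k. (norm ((1 / real k) *\<^sub>R ?y k + \<alpha> *\<^sub>R v))\<^sup>2) \<longlonglongrightarrow> 0"
  proof (rule LIMSEQ_I)
    fix e :: real assume e: "e > 0"
    \<comment> \<open>One \<open>r\<close> will bound the influence of the starting point and one the excess speed of the orbit of \<open>q\<close>.\<close>
    have "isCont (\<lambda>r. (r + \<alpha> * (norm v + r))\<^sup>2) 0" by (intro continuous_intros)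
    then have "((\<lambda>r. (r + \<alpha> * (norm v + r))\<^sup>2) \<longlongrightarrow> (0 + \<alpha> * (norm v + 0))\<^sup>2) (at_right 0)"
      by (simp add: isCont_def filterlim_at_split)
    then have "\<forall>\<^sub>F r in at_right 0. (r + \<alpha> * (norm v + r))\<^sup>2 < \<alpha>\<^sup>2 * (norm v)\<^sup>2 + e"
      by (rule order_tendstoD) (use e in \<open>simp add: power_mult_distrib\<close>)
    moreover have "\<forall>\<^sub>F r in at_right (0::real). 0 < r" by (simp add: eventually_at_right_less)
    ultimately obtain r :: real where r: "r > 0" "(r + \<alpha> * (norm v + r))\<^sup>2 < \<alpha>\<^sup>2 * (norm v)\<^sup>2 + e"
      using eventually_happens'[OF trivial_limit_at_right_real eventually_conj] by blast
    obtain s where s: "s \<in> range S" "dist s v < r" using v(1) r(1) by (metis closure_approachable)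
    then obtain q where q: "dist (S q) v < r" by blast
    then have Sq: "norm (S q) \<le> norm v + r"
      using norm_triangle_ineq2[of "S q" v] by (simp add: dist_norm)
    obtain k0 where k0: "real k0 > 2 * norm q / r" using reals_Archimedean2 by blast
    have "norm ((norm ((1 / real k) *\<^sub>R ?y k + \<alpha> *\<^sub>R v))\<^sup>2 - 0) < e" if k: "k \<ge> Suc k0" for k
    proof -
      have kpos: "real k > 0" using k by simp
      have "2 * norm q / r < real k" using k0 k by linarith
      then have "2 * norm q / real k \<le> r" using r(1) kpos by (simp add: field_simps)
      moreover have "norm (?y k) / real k \<le> 2 * norm q / real k + \<alpha> * norm (S q)"
        using upper[of k q] kpos by (simp add: field_simps)
      moreover have "\<alpha> * norm (S q) \<le> \<alpha> * (norm v + r)" using Sq \<alpha> by simp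
      ultimately have "norm (?y k) / real k \<le> r + \<alpha> * (norm v + r)" by linarith
      then have "(norm (?y k) / real k)\<^sup>2 \<le> (r + \<alpha> * (norm v + r))\<^sup>2" by (intro power_mono) auto
      then show ?thesis using dist2[of k] r(2) kpos by simp
    qed
    then show "\<exists>no. \<forall>k\<ge>no. norm ((norm ((1 / real k) *\<^sub>R ?y k + \<alpha> *\<^sub>R v))\<^sup>2 - 0) < e" by blast
  qed
  then have "(\<lambda>k. norm ((1 / real k) *\<^sub>R ?y k + \<alpha> *\<^sub>R v)) \<longlonglongrightarrow> 0"
    using tendsto_real_sqrt by fastforce
  then show ?thesis by (subst LIM_zero_iff[symmetric]) (simp add: tendsto_norm_zero_iff)
qed

section \<open>Randomized fixed-point iterations\<close>

lemma norm_add_squared_le: "(norm (p + q))\<^sup>2 \<le> 2 * (norm p)\<^sup>2 + 2 * (norm q)\<^sup>2"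
proof -
  have "(norm (p + q))\<^sup>2 \<le> (norm p + norm q)\<^sup>2" by (intro power_mono norm_triangle_ineq) simp
  then show ?thesis using sum_squares_bound[of "norm p" "norm q"] by (simp add: power2_sum)
qed

text \<open>The increments of \<open>a k = \<bar>e k\<bar>\<^sup>2 / (k + 1)\<^sup>2\<close> are absolutely summable: the mixed term
  \<open>\<bar>e k\<bar> \<bar>e (k+1) - e k\<bar> / k\<^sup>2\<close> is split by the arithmetic-geometric mean inequality into the terms of the
  two given series, which is why the exponents are \<open>5/2\<close> and \<open>3/2\<close>. So \<open>a\<close> converges, and the first
  series forces the limit to be 0. For the random iteration this replaces a martingale convergence
  theorem: both series have finite expectation there.\<close>

lemma scaled_sequence_tendsto_zero:
  fixes e :: "nat \<Rightarrow> 'a::real_normed_vector"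
  assumes s1: "summable (\<lambda>k. (norm (e k))\<^sup>2 / sqrt (real (Suc k)) ^ 5)"
    and s2: "summable (\<lambda>k. (norm (e (Suc k) - e k))\<^sup>2 / sqrt (real (Suc k)) ^ 3)"
  shows "(\<lambda>k. (1 / real k) *\<^sub>R e k) \<longlonglongrightarrow> 0"
proof -
  define r where "r k = sqrt (real (Suc k))" for k
  have r1: "r k \<ge> 1" for k by (simp add: r_def)
  have rr: "r k ^ 2 = real (Suc k)" for k by (simp add: r_def)
  define a where "a k = (norm (e k))\<^sup>2 / (real (Suc k))\<^sup>2" for k
  have a0: "a k \<ge> 0" for k by (simp add: a_def)
  have ar: "a k = (norm (e k))\<^sup>2 / r k ^ 4" for k
    unfolding a_def rr[symmetric] by (simp flip: power_mult)
  have step: "\<bar>a (Suc k) - a k\<bar> \<le> 3 * ((norm (e k))\<^sup>2 / r k ^ 5) + 2 * ((norm (e (Suc k) - e k))\<^sup>2 / r k ^ 3)" for k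
  proof -
    define x where "x = norm (e k)"
    define d where "d = norm (e (Suc k) - e k)"
    define y where "y = norm (e (Suc k))"
    define \<rho> where "\<rho> = r k"
    have xd: "x \<ge> 0" "d \<ge> 0" "y \<ge> 0" by (auto simp: x_def d_def y_def)
    have yx: "\<bar>y - x\<bar> \<le> d" unfolding x_def y_def d_def by (rule norm_triangle_ineq3)
    have \<rho>: "\<rho> \<ge> 1" using r1 by (simp add: \<rho>_def)
    have \<rho>2: "real (Suc k) = \<rho> ^ 2" by (simp only: \<rho>_def rr)
    have n2: "(real (Suc (Suc k)))\<^sup>2 = (\<rho> ^ 2 + 1)\<^sup>2" using \<rho>2 by simp
    have am: "2 * x * d / \<rho> ^ 4 \<le> x\<^sup>2 / \<rho> ^ 5 + d\<^sup>2 / \<rho> ^ 3"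
    proof -
      have "0 \<le> (x - \<rho> * d)\<^sup>2 / \<rho> ^ 5" using \<rho> by simp
      also have "\<dots> = x\<^sup>2 / \<rho> ^ 5 + d\<^sup>2 / \<rho> ^ 3 - 2 * x * d / \<rho> ^ 4"
        using \<rho> by (simp add: field_simps power2_eq_square eval_nat_numeral)
      finally show ?thesis by simp
    qed
    have "\<bar>y\<^sup>2 - x\<^sup>2\<bar> = \<bar>y - x\<bar> * (y + x)"
      using xd by (simp add: power2_eq_square square_diff_square_factored abs_mult)
    also have "\<dots> \<le> d * (2 * x + d)" using yx xd by (intro mult_mono) auto
    finally have yx2: "\<bar>y\<^sup>2 - x\<^sup>2\<bar> \<le> 2 * x * d + d\<^sup>2" by (simp add: power2_eq_square algebra_simps)
    have "a (Suc k) - a k = (y\<^sup>2 - x\<^sup>2) / (\<rho> ^ 2 + 1)\<^sup>2 - x\<^sup>2 * (1 / \<rho> ^ 4 - 1 / (\<rho> ^ 2 + 1)\<^sup>2)"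
      unfolding ar[of k] a_def[of "Suc k"] n2 by (simp add: x_def y_def \<rho>_def algebra_simps diff_divide_distrib)
    moreover have "\<bar>(y\<^sup>2 - x\<^sup>2) / (\<rho> ^ 2 + 1)\<^sup>2\<bar> \<le> 2 * x * d / \<rho> ^ 4 + d\<^sup>2 / \<rho> ^ 4"
    proof -
      have "\<rho> ^ 4 \<le> (\<rho> ^ 2 + 1)\<^sup>2" using \<rho> by (simp add: power2_eq_square eval_nat_numeral algebra_simps)
      then have "\<bar>(y\<^sup>2 - x\<^sup>2) / (\<rho> ^ 2 + 1)\<^sup>2\<bar> \<le> (2 * x * d + d\<^sup>2) / \<rho> ^ 4"
        using yx2 \<rho> xd by (simp add: abs_divide frac_le)
      then show ?thesis by (simp add: add_divide_distrib)
    qed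
    moreover have "0 \<le> 1 / \<rho> ^ 4 - 1 / (\<rho> ^ 2 + 1)\<^sup>2 \<and> 1 / \<rho> ^ 4 - 1 / (\<rho> ^ 2 + 1)\<^sup>2 \<le> 2 / \<rho> ^ 5"
    proof
      have le: "\<rho> ^ 4 \<le> (\<rho> ^ 2 + 1)\<^sup>2" using \<rho> by (simp add: power2_eq_square eval_nat_numeral algebra_simps)
      then show "0 \<le> 1 / \<rho> ^ 4 - 1 / (\<rho> ^ 2 + 1)\<^sup>2" using \<rho> by (simp add: frac_le)
      have "\<rho> ^ 2 + 1 > 0" using zero_le_power2[of \<rho>] by linarith
      then have pos: "(\<rho> ^ 2 + 1)\<^sup>2 > 0" by (rule zero_less_power)
      have "1 / \<rho> ^ 4 - 1 / (\<rho> ^ 2 + 1)\<^sup>2 = (2 * \<rho> ^ 2 + 1) / (\<rho> ^ 4 * (\<rho> ^ 2 + 1)\<^sup>2)"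
        using \<rho> pos by (simp add: divide_simps) (simp add: algebra_simps eval_nat_numeral)
      also have "\<dots> \<le> 2 * (\<rho> ^ 2 + 1) / (\<rho> ^ 4 * (\<rho> ^ 2 + 1)\<^sup>2)"
        using \<rho> pos by (intro divide_right_mono) auto
      also have "\<dots> = 2 / (\<rho> ^ 4 * (\<rho> ^ 2 + 1))"
      proof -
        have "2 * q / (s * q\<^sup>2) = 2 / (s * q)" if "q \<noteq> 0" for q s :: real
          using that by (simp add: power2_eq_square)
        moreover have "\<rho> ^ 2 + 1 \<noteq> 0" using pos by auto
        ultimately show ?thesis .
      qed
      also have "\<dots> \<le> 2 / \<rho> ^ 5"
      proof (rule divide_left_mono)
        have "\<rho> * \<rho> ^ 4 \<le> (\<rho> ^ 2 + 1) * \<rho> ^ 4"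
          using \<rho> by (intro mult_right_mono) (auto simp: power2_eq_square intro: order_trans[of \<rho> "\<rho> * \<rho>"])
        then show "\<rho> ^ 5 \<le> \<rho> ^ 4 * (\<rho> ^ 2 + 1)" by (simp add: eval_nat_numeral mult_ac)
      qed (use \<rho> pos in \<open>auto intro!: mult_pos_pos add_pos_pos\<close>)
      finally show "1 / \<rho> ^ 4 - 1 / (\<rho> ^ 2 + 1)\<^sup>2 \<le> 2 / \<rho> ^ 5" .
    qed
    then have "0 \<le> x\<^sup>2 * (1 / \<rho> ^ 4 - 1 / (\<rho> ^ 2 + 1)\<^sup>2) \<and> x\<^sup>2 * (1 / \<rho> ^ 4 - 1 / (\<rho> ^ 2 + 1)\<^sup>2) \<le> 2 * (x\<^sup>2 / \<rho> ^ 5)"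
      using mult_left_mono[of "1 / \<rho> ^ 4 - 1 / (\<rho> ^ 2 + 1)\<^sup>2" "2 / \<rho> ^ 5" "x\<^sup>2"]
      by (simp add: mult.commute[of 2])
    moreover have "d\<^sup>2 / \<rho> ^ 4 \<le> d\<^sup>2 / \<rho> ^ 3" using \<rho> by (intro divide_left_mono power_increasing) auto
    ultimately have "\<bar>a (Suc k) - a k\<bar> \<le> 3 * (x\<^sup>2 / \<rho> ^ 5) + 2 * (d\<^sup>2 / \<rho> ^ 3)"
      using am by linarith
    then show ?thesis by (simp add: x_def d_def \<rho>_def)
  qed
  have "summable (\<lambda>k. 3 * ((norm (e k))\<^sup>2 / r k ^ 5) + 2 * ((norm (e (Suc k) - e k))\<^sup>2 / r k ^ 3))"
    using s1 s2 by (intro summable_add summable_mult) (simp_all add: r_def)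
  then have "summable (\<lambda>k. a (Suc k) - a k)"
    by (rule summable_comparison_test[rotated]) (use step in auto)
  then have "(\<lambda>n. \<Sum>k<n. a (Suc k) - a k) \<longlonglongrightarrow> (\<Sum>k. a (Suc k) - a k)" by (rule summable_LIMSEQ)
  then have "(\<lambda>n. (a n - a 0) + a 0) \<longlonglongrightarrow> (\<Sum>k. a (Suc k) - a k) + a 0"
    unfolding sum_lessThan_telescope by (rule tendsto_add) simp
  then obtain L where L: "a \<longlonglongrightarrow> L" by auto
  have "L \<ge> 0" using L a0 by (intro LIMSEQ_le_const) auto
  \<comment> \<open>A positive limit would make the first series dominate a harmonic series.\<close>
  moreover have "\<not> L > 0"
  proof
    assume "L > 0"
    then have "\<forall>\<^sub>F k in sequentially. a k > L / 2" using order_tendstoD(1)[OF L, of "L/2"] by simp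
    then obtain n where n: "\<And>k. k \<ge> n \<Longrightarrow> a k > L / 2" by (auto simp: eventually_sequentially)
    have "norm (inverse (real (Suc k))) \<le> (2 / L) * ((norm (e k))\<^sup>2 / r k ^ 5)" if k: "k \<ge> n" for k
    proof -
      have "inverse (real (Suc k)) = 1 / r k ^ 2" unfolding rr by (simp add: inverse_eq_divide)
      also have "\<dots> \<le> 1 / r k" using r1[of k] by (intro divide_left_mono) (auto simp: power2_eq_square)
      also have "\<dots> \<le> (2 / L * a k) / r k" using n[OF k] \<open>L > 0\<close> r1[of k] by (intro divide_right_mono) (auto simp: field_simps)
      also have "\<dots> = (2 / L) * ((norm (e k))\<^sup>2 / r k ^ 5)" unfolding ar by (simp add: eval_nat_numeral)
      finally show ?thesis by simp
    qed
    moreover have "summable (\<lambda>k. (2 / L) * ((norm (e k))\<^sup>2 / r k ^ 5))"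
      using s1 by (intro summable_mult) (simp add: r_def)
    ultimately have "summable (\<lambda>k. inverse (real (Suc k)))"
      by (intro summable_comparison_test[of "\<lambda>k. inverse (real (Suc k))"]) auto
    then have "summable (\<lambda>k. inverse (real k))" by (subst (asm) summable_Suc_iff)
    then show False using not_summable_harmonic[where 'a=real] by simp
  qed
  ultimately have "L = 0" by simp
  then have "(\<lambda>k. 2 * sqrt (a k)) \<longlonglongrightarrow> 2 * sqrt 0" using L by (intro tendsto_intros) simp
  then have lim: "(\<lambda>k. 2 * sqrt (a k)) \<longlonglongrightarrow> 0" by simp
  show ?thesis
  proof (rule Lim_null_comparison[OF _ lim])
    have "norm ((1 / real k) *\<^sub>R e k) \<le> 2 * sqrt (a k)" for k
    proof (cases "k = 0")
      case False
      have "sqrt (a k) = norm (e k) / real (Suc k)" by (simp add: a_def real_sqrt_divide)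
      moreover have "norm (e k) / real k \<le> 2 * norm (e k) / real (Suc k)"
        using False mult_right_mono[of 1 "real k" "norm (e k)"] by (simp add: field_simps)
      ultimately show ?thesis by simp
    qed (use a0 in auto)
    then show "\<forall>\<^sub>F k in sequentially. norm ((1 / real k) *\<^sub>R e k) \<le> 2 * sqrt (a k)" by simp
  qed
qed

lemma summable_inverse_sqrt_cubed: "summable (\<lambda>k. 1 / sqrt (real (Suc k)) ^ 3)"
proof -
  have "1 / sqrt (real (Suc k)) ^ 3 = real (Suc k) powr (- 3 / 2)" for k
  proof -
    have "sqrt (real (Suc k)) ^ 3 = (real (Suc k) powr (1/2)) powr 3"
      by (simp add: powr_half_sqrt powr_numeral)
    also have "\<dots> = real (Suc k) powr (3 / 2)" by (simp only: powr_powr) simp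
    finally show ?thesis by (simp add: powr_minus inverse_eq_divide)
  qed
  moreover have "summable (\<lambda>k. real (Suc k) powr (- 3 / 2))"
    by (subst summable_Suc_iff) (simp add: summable_real_powr_iff)
  ultimately show ?thesis by simp
qed

text \<open>Summation by parts, in the form of a telescoping bound for \<open>w n * m n\<close>.\<close>

lemma weighted_drift_summable:
  fixes m a w :: "nat \<Rightarrow> real"
  assumes drift: "\<And>k. m (Suc k) + \<eta> * a k \<le> m k + C" and \<eta>: "\<eta> > 0" and m0: "m 0 = 0"
    and nonneg: "\<And>k. 0 \<le> m k" "\<And>k. 0 \<le> a k" "\<And>k. 0 \<le> w k" and C: "0 \<le> C"
    and w: "decseq w" "summable w"
  shows "summable (\<lambda>k. w k * a k)"
proof (rule summableI_nonneg_bounded)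
  fix n
  have "(\<Sum>k<n. \<eta> * (w k * a k)) + w n * m n \<le> C * (\<Sum>k<n. w k)"
  proof (induction n)
    case (Suc n)
    have "w (Suc n) * m (Suc n) \<le> w n * m (Suc n)"
      using w(1) nonneg by (intro mult_right_mono) (auto simp: decseq_Suc_iff)
    moreover have "w n * (m (Suc n) + \<eta> * a n) \<le> w n * (m n + C)"
      using drift nonneg by (intro mult_left_mono) auto
    ultimately show ?case using Suc by (simp add: algebra_simps)
  qed (simp add: m0)
  moreover have "0 \<le> w n * m n" using nonneg by simp
  moreover have "C * (\<Sum>k<n. w k) \<le> C * (\<Sum>k. w k)"
    using C w(2) nonneg by (intro mult_left_mono sum_le_suminf) auto
  ultimately have "\<eta> * (\<Sum>k<n. w k * a k) \<le> C * (\<Sum>k. w k)" by (simp add: sum_distrib_left)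
  then show "(\<Sum>k<n. w k * a k) \<le> C * (\<Sum>k. w k) / \<eta>" using \<eta> by (simp add: field_simps)
qed (use nonneg in auto)

lemma AE_summable_of_nn_integral_le:
  fixes g :: "nat \<Rightarrow> 'w \<Rightarrow> real"
  assumes g[measurable]: "\<And>k. g k \<in> borel_measurable M" and g0: "\<And>k \<omega>. 0 \<le> g k \<omega>"
    and le: "\<And>k. (\<integral>\<^sup>+\<omega>. ennreal (g k \<omega>) \<partial>M) \<le> ennreal (b k)" and b: "\<And>k. 0 \<le> b k" "summable b"
  shows "AE \<omega> in M. summable (\<lambda>k. g k \<omega>)"
proof -
  have "(\<integral>\<^sup>+\<omega>. (\<Sum>k. ennreal (g k \<omega>)) \<partial>M) = (\<Sum>k. \<integral>\<^sup>+\<omega>. ennreal (g k \<omega>) \<partial>M)"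
    by (rule nn_integral_suminf) simp
  also have "\<dots> \<le> (\<Sum>k. ennreal (b k))" using le by (intro suminf_le) auto
  also have "\<dots> = ennreal (\<Sum>k. b k)" using b by (intro suminf_ennreal2) auto
  also have "\<dots> < \<infinity>" by simp
  finally have "AE \<omega> in M. (\<Sum>k. ennreal (g k \<omega>)) \<noteq> \<infinity>" by (intro nn_integral_PInf_AE) auto
  then show ?thesis using g0 by (auto intro: summable_suminf_not_top)
qed

primrec randomized_orbit :: "('s \<Rightarrow> 'a \<Rightarrow> 'a) \<Rightarrow> ('a::real_vector \<Rightarrow> 'a) \<Rightarrow> (nat \<Rightarrow> 's) \<Rightarrow> nat \<Rightarrow> 'a" where
  "randomized_orbit \<Lambda> S \<sigma> 0 = 0"
| "randomized_orbit \<Lambda> S \<sigma> (Suc k) =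
     randomized_orbit \<Lambda> S \<sigma> k - \<Lambda> (\<sigma> k) (S (randomized_orbit \<Lambda> S \<sigma> k))"

lemma randomized_orbit_restrict:
  "{..<k} \<subseteq> I \<Longrightarrow> randomized_orbit \<Lambda> S (restrict \<sigma> I) k = randomized_orbit \<Lambda> S \<sigma> k"
  by (induction k) (auto simp: lessThan_Suc)

lemma randomized_orbit_measurable:
  fixes \<Lambda> :: "'s::topological_space \<Rightarrow> 'a::euclidean_space \<Rightarrow> 'a"
  assumes \<Lambda>: "(\<lambda>(s, p). \<Lambda> s p) \<in> borel_measurable (borel \<Otimes>\<^sub>M borel)" and S: "S \<in> borel_measurable borel"
  shows "{..<k} \<subseteq> I \<Longrightarrow> (\<lambda>\<sigma>. randomized_orbit \<Lambda> S \<sigma> k) \<in> borel_measurable (PiM I (\<lambda>_. borel))"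
proof (induction k)
  case (Suc k)
  then have IH[measurable]: "(\<lambda>\<sigma>. randomized_orbit \<Lambda> S \<sigma> k) \<in> borel_measurable (PiM I (\<lambda>_. borel))"
    and [measurable]: "(\<lambda>\<sigma>. \<sigma> k) \<in> borel_measurable (PiM I (\<lambda>_. borel))"
    by (auto intro!: measurable_component_singleton simp: lessThan_Suc)
  note S[measurable]
  have "(\<lambda>\<sigma>. (\<sigma> k, S (randomized_orbit \<Lambda> S \<sigma> k))) \<in> PiM I (\<lambda>_. borel) \<rightarrow>\<^sub>M borel \<Otimes>\<^sub>M borel"
    by measurable
  from measurable_compose[OF this \<Lambda>]
  have [measurable]: "(\<lambda>\<sigma>. \<Lambda> (\<sigma> k) (S (randomized_orbit \<Lambda> S \<sigma> k))) \<in> borel_measurable (PiM I (\<lambda>_. borel))"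
    by simp
  show ?case by simp
qed simp

text \<open>The update direction \<open>\<Lambda> s (S x)\<close> is a random version of \<open>\<alpha> S x\<close>. The second moment condition
  combines unbiasedness with a variance bound; \<open>\<alpha> (2 - \<alpha>) \<bar>S x - S y\<bar>\<^sup>2\<close> is a lower bound for the decrease
  of squared distances in the deterministic relaxed step, so \<open>c < \<alpha> (2 - \<alpha>)\<close> says that the decrease
  dominates the variance.\<close>

locale randomized_fixed_point_iteration = prob_space M
  for M :: "'w measure" +
  fixes S :: "'a::euclidean_space \<Rightarrow> 'a" and \<Lambda> :: "'s::euclidean_space \<Rightarrow> 'a \<Rightarrow> 'a"
    and D :: "'s measure" and X :: "nat \<Rightarrow> 'w \<Rightarrow> 's" and \<alpha> c :: real
  assumes firm: "\<And>x y. (norm (S x - S y))\<^sup>2 \<le> (S x - S y) \<bullet> (x - y)"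
    and \<alpha>: "0 < \<alpha>" "\<alpha> \<le> 1"
    and c: "0 \<le> c" "c < \<alpha> * (2 - \<alpha>)"
    and measurable_\<Lambda>: "(\<lambda>(s, p). \<Lambda> s p) \<in> borel_measurable (borel \<Otimes>\<^sub>M borel)"
    and indep: "indep_vars (\<lambda>_. borel) X UNIV"
    and distr_X: "\<And>k. distr M borel (X k) = D"
    and second_moment: "\<And>a p. (\<integral>\<^sup>+s. ennreal ((norm (a - \<Lambda> s p))\<^sup>2) \<partial>D)
       \<le> ennreal ((norm (a - \<alpha> *\<^sub>R p))\<^sup>2 + c * (norm p)\<^sup>2)"
begin

definition z :: "nat \<Rightarrow> 'w \<Rightarrow> 'a" where
  "z k \<omega> = randomized_orbit \<Lambda> S (\<lambda>n. X n \<omega>) k"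

abbreviation y :: "nat \<Rightarrow> 'a" where
  "y \<equiv> relaxed_orbit \<alpha> S 0"

definition e :: "nat \<Rightarrow> 'w \<Rightarrow> 'a" where
  "e k \<omega> = z k \<omega> - y k"

lemma S_measurable [measurable]: "S \<in> borel_measurable borel"
proof (intro borel_measurable_continuous_onI continuous_on_iff[THEN iffD2] ballI allI impI)
  fix x and \<epsilon> :: real assume "0 < \<epsilon>"
  then show "\<exists>d>0. \<forall>x'\<in>UNIV. dist x' x < d \<longrightarrow> dist (S x') (S x) < \<epsilon>"
    using firm_displacement_lipschitz[OF firm] by (metis dist_norm le_less_trans)
qed

lemma X_measurable [measurable]: "X k \<in> borel_measurable M"
  using indep by (auto simp: indep_vars_def)

lemma z_measurable [measurable]: "z k \<in> borel_measurable M"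
proof -
  have "(\<lambda>\<omega>. \<lambda>n\<in>UNIV. X n \<omega>) \<in> M \<rightarrow>\<^sub>M PiM UNIV (\<lambda>_. borel)" by (intro measurable_restrict) simp
  from measurable_compose[OF this randomized_orbit_measurable[OF measurable_\<Lambda> S_measurable, of k]]
  show ?thesis unfolding z_def[abs_def] by (simp add: randomized_orbit_restrict)
qed

text \<open>The sample of pass \<open>k\<close> is independent of the iterate \<open>z k\<close>, a function of the earlier samples, so
  that a bound for frozen \<open>x\<close> may be integrated.\<close>

lemma nn_integral_sample_le:
  assumes h[measurable]: "h \<in> borel_measurable (borel \<Otimes>\<^sub>M borel)" and g[measurable]: "g \<in> borel_measurable borel"
    and le: "\<And>x. (\<integral>\<^sup>+s. h (x, s) \<partial>D) \<le> g x"
  shows "(\<integral>\<^sup>+\<omega>. h (z k \<omega>, X k \<omega>) \<partial>M) \<le> (\<integral>\<^sup>+\<omega>. g (z k \<omega>) \<partial>M)"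
proof -
  let ?P = "PiM {..<k} (\<lambda>_. borel :: 's measure)" and ?Q = "PiM {k} (\<lambda>_. borel :: 's measure)"
  define past where "past \<omega> = restrict (\<lambda>n. X n \<omega>) {..<k}" for \<omega>
  define now where "now \<omega> = restrict (\<lambda>n. X n \<omega>) {k}" for \<omega>
  define G where "G \<sigma> = randomized_orbit \<Lambda> S \<sigma> k" for \<sigma>
  have Gpast: "G (past \<omega>) = z k \<omega>" for \<omega>
    by (simp add: G_def past_def z_def randomized_orbit_restrict)
  have nowk: "now \<omega> k = X k \<omega>" for \<omega> by (simp add: now_def)
  have [measurable]: "past \<in> M \<rightarrow>\<^sub>M ?P" "now \<in> M \<rightarrow>\<^sub>M ?Q"
    unfolding past_def[abs_def] now_def[abs_def] by (auto intro!: measurable_restrict)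
  have [measurable]: "G \<in> borel_measurable ?P"
    unfolding G_def[abs_def] by (rule randomized_orbit_measurable[OF measurable_\<Lambda> S_measurable]) simp
  have [measurable]: "(\<lambda>\<sigma>. \<sigma> k) \<in> borel_measurable ?Q" by (rule measurable_component_singleton) simp
  interpret now: prob_space "distr M ?Q now" by (rule prob_space_distr) measurable
  have joint: "distr M ?P past \<Otimes>\<^sub>M distr M ?Q now = distr M (?P \<Otimes>\<^sub>M ?Q) (\<lambda>\<omega>. (past \<omega>, now \<omega>))"
    using indep_var_restrict[OF indep, of "{..<k}" "{k}"]
    unfolding indep_var_distribution_eq past_def[abs_def] now_def[abs_def] by simp
  have "(\<integral>\<^sup>+\<omega>. h (z k \<omega>, X k \<omega>) \<partial>M) = (\<integral>\<^sup>+\<omega>. h (G (past \<omega>), now \<omega> k) \<partial>M)"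
    by (simp add: Gpast nowk)
  also have "\<dots> = (\<integral>\<^sup>+q. h (G (fst q), snd q k) \<partial>(distr M (?P \<Otimes>\<^sub>M ?Q) (\<lambda>\<omega>. (past \<omega>, now \<omega>))))"
    by (subst nn_integral_distr) simp_all
  also have "\<dots> = (\<integral>\<^sup>+q. h (G (fst q), snd q k) \<partial>(distr M ?P past \<Otimes>\<^sub>M distr M ?Q now))"
    by (simp only: joint)
  also have "\<dots> = (\<integral>\<^sup>+\<sigma>. \<integral>\<^sup>+\<sigma>'. h (G \<sigma>, \<sigma>' k) \<partial>(distr M ?Q now) \<partial>(distr M ?P past))"
    by (subst now.nn_integral_fst[symmetric]) simp_all
  also have "\<dots> \<le> (\<integral>\<^sup>+\<sigma>. g (G \<sigma>) \<partial>(distr M ?P past))"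
  proof (rule nn_integral_mono)
    fix \<sigma>
    have "(\<integral>\<^sup>+\<sigma>'. h (G \<sigma>, \<sigma>' k) \<partial>(distr M ?Q now)) = (\<integral>\<^sup>+\<omega>. h (G \<sigma>, X k \<omega>) \<partial>M)"
      by (subst nn_integral_distr) (simp_all add: nowk)
    also have "\<dots> = (\<integral>\<^sup>+s. h (G \<sigma>, s) \<partial>D)"
      unfolding distr_X[of k, symmetric] by (subst nn_integral_distr) simp_all
    also have "\<dots> \<le> g (G \<sigma>)" by (rule le)
    finally show "(\<integral>\<^sup>+\<sigma>'. h (G \<sigma>, \<sigma>' k) \<partial>(distr M ?Q now)) \<le> g (G \<sigma>)" .
  qed
  also have "\<dots> = (\<integral>\<^sup>+\<omega>. g (z k \<omega>) \<partial>M)" by (subst nn_integral_distr) (simp_all add: Gpast)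
  finally show ?thesis .
qed

text \<open>The excess of the decrease over the variance is shared equally: one half, \<open>gap\<close>, remains in the one-step
  estimate, and the other half absorbs the mixed term of \<open>\<bar>S x\<bar>\<^sup>2 = \<bar>(S x - S (y k)) + S (y k)\<bar>\<^sup>2\<close>.\<close>

definition gap :: real where "gap = (\<alpha> * (2 - \<alpha>) - c) / 2"

definition drift :: real where "drift = c * (1 + c / gap) * (norm (S 0))\<^sup>2"

lemma gap_pos: "gap > 0" using c by (simp add: gap_def)

lemma drift_nonneg: "drift \<ge> 0" using c gap_pos by (simp add: drift_def)

lemma S_y_bound: "norm (S (y k)) \<le> norm (S 0)"
  by (rule relaxed_orbit_displacement_bound[OF firm \<alpha>])

lemma e_step: "e (Suc k) \<omega> = (z k \<omega> - y (Suc k)) - \<Lambda> (X k \<omega>) (S (z k \<omega>))"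
  by (simp add: e_def z_def)

text \<open>The left-hand side bounds the conditional expectation of the next squared distance to the
  deterministic orbit, plus a multiple of \<open>\<bar>S x - S (y k)\<bar>\<^sup>2\<close>. As \<open>S\<close> may have no zero, the variance
  does not vanish along the orbit and leaves the constant \<open>drift\<close>; a bounded increase per step is harmless
  after division by \<open>k\<^sup>2\<close>.\<close>

lemma one_step_estimate:
  "(norm (x - y (Suc k) - \<alpha> *\<^sub>R S x))\<^sup>2 + c * (norm (S x))\<^sup>2 + gap * (norm (S x - S (y k)))\<^sup>2
     \<le> (norm (x - y k))\<^sup>2 + drift"
proof -
  define d where "d = S x - S (y k)"
  define b where "b = S (y k)"
  have Sx: "S x = d + b" by (simp add: d_def b_def)
  have nb: "(norm b)\<^sup>2 \<le> (norm (S 0))\<^sup>2" unfolding b_def by (intro power_mono S_y_bound) simp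
  have "x - y (Suc k) - \<alpha> *\<^sub>R S x = (x - y k) - \<alpha> *\<^sub>R d" by (simp add: d_def algebra_simps)
  then have "(norm (x - y (Suc k) - \<alpha> *\<^sub>R S x))\<^sup>2 = (norm (x - y k))\<^sup>2 - 2 * \<alpha> * (d \<bullet> (x - y k)) + \<alpha>\<^sup>2 * (norm d)\<^sup>2"
    unfolding power2_norm_eq_inner
    by (simp only:) (simp add: inner_diff_left inner_diff_right inner_commute algebra_simps power2_eq_square)
  moreover have "\<alpha> * (norm d)\<^sup>2 \<le> \<alpha> * (d \<bullet> (x - y k))" using firm[of x "y k"] \<alpha> by (simp add: d_def)
  ultimately have 1: "(norm (x - y (Suc k) - \<alpha> *\<^sub>R S x))\<^sup>2 \<le> (norm (x - y k))\<^sup>2 - \<alpha> * (2 - \<alpha>) * (norm d)\<^sup>2"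
    by (simp add: algebra_simps power2_eq_square)
  have 2: "c * (norm (S x))\<^sup>2 \<le> c * (norm d)\<^sup>2 + gap * (norm d)\<^sup>2 + drift"
  proof -
    have "c * (2 * norm d * norm b) \<le> gap * (norm d)\<^sup>2 + c\<^sup>2 / gap * (norm b)\<^sup>2"
    proof -
      have "0 \<le> (gap * norm d - c * norm b)\<^sup>2 / gap" using gap_pos by simp
      also have "\<dots> = gap * (norm d)\<^sup>2 + c\<^sup>2 / gap * (norm b)\<^sup>2 - c * (2 * norm d * norm b)"
        using gap_pos by (simp add: field_simps power2_eq_square)
      finally show ?thesis by simp
    qed
    moreover have "(norm (d + b))\<^sup>2 \<le> (norm d)\<^sup>2 + 2 * norm d * norm b + (norm b)\<^sup>2"
      using power_mono[OF norm_triangle_ineq[of d b], of 2] by (simp add: power2_sum)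
    then have "c * (norm (d + b))\<^sup>2 \<le> c * ((norm d)\<^sup>2 + 2 * norm d * norm b + (norm b)\<^sup>2)"
      using c(1) by (rule mult_left_mono)
    moreover have "c * (1 + c / gap) * (norm b)\<^sup>2 \<le> drift"
      unfolding drift_def using nb c gap_pos by (intro mult_left_mono) auto
    ultimately show ?thesis by (simp add: Sx algebra_simps power2_eq_square)
  qed
  have "\<alpha> * (2 - \<alpha>) * (norm d)\<^sup>2 = c * (norm d)\<^sup>2 + 2 * (gap * (norm d)\<^sup>2)"
    by (simp add: gap_def field_simps)
  then show ?thesis using 1 2 unfolding d_def[symmetric] by linarith
qed

lemma expected_one_step:
  "(\<integral>\<^sup>+\<omega>. ennreal ((norm (e (Suc k) \<omega>))\<^sup>2) \<partial>M) + (\<integral>\<^sup>+\<omega>. ennreal (gap * (norm (S (z k \<omega>) - S (y k)))\<^sup>2) \<partial>M)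
    \<le> (\<integral>\<^sup>+\<omega>. ennreal ((norm (e k \<omega>))\<^sup>2) \<partial>M) + ennreal drift"
proof -
  interpret D: prob_space D using prob_space_distr[OF X_measurable] distr_X by metis
  have sets_D[measurable_cong]: "sets D = sets borel" using distr_X sets_distr by metis
  define h where "h = (\<lambda>(x, s). ennreal ((norm (x - y (Suc k) - \<Lambda> s (S x)))\<^sup>2) + ennreal (gap * (norm (S x - S (y k)))\<^sup>2))"
  have "(\<lambda>q :: 'a \<times> 's. (snd q, S (fst q))) \<in> borel \<Otimes>\<^sub>M borel \<rightarrow>\<^sub>M borel \<Otimes>\<^sub>M borel" by measurable
  from measurable_compose[OF this measurable_\<Lambda>]
  have [measurable]: "(\<lambda>q. \<Lambda> (snd q) (S (fst q))) \<in> borel_measurable (borel \<Otimes>\<^sub>M borel)" by simp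
  have h: "h \<in> borel_measurable (borel \<Otimes>\<^sub>M borel)" unfolding h_def case_prod_beta by measurable
  have "(\<integral>\<^sup>+s. h (x, s) \<partial>D) \<le> ennreal ((norm (x - y k))\<^sup>2 + drift)" for x
  proof -
    have "(\<lambda>s. (s, S x)) \<in> D \<rightarrow>\<^sub>M borel \<Otimes>\<^sub>M borel" by measurable
    from measurable_compose[OF this measurable_\<Lambda>]
    have [measurable]: "(\<lambda>s. \<Lambda> s (S x)) \<in> borel_measurable D" by simp
    have "(\<integral>\<^sup>+s. h (x, s) \<partial>D) = (\<integral>\<^sup>+s. ennreal ((norm (x - y (Suc k) - \<Lambda> s (S x)))\<^sup>2) \<partial>D)
        + ennreal (gap * (norm (S x - S (y k)))\<^sup>2)"
      unfolding h_def by (simp add: nn_integral_add D.emeasure_space_1)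
    also have "\<dots> \<le> ennreal ((norm (x - y (Suc k) - \<alpha> *\<^sub>R S x))\<^sup>2 + c * (norm (S x))\<^sup>2)
        + ennreal (gap * (norm (S x - S (y k)))\<^sup>2)"
      by (intro add_right_mono second_moment)
    also have "\<dots> = ennreal ((norm (x - y (Suc k) - \<alpha> *\<^sub>R S x))\<^sup>2 + c * (norm (S x))\<^sup>2
        + gap * (norm (S x - S (y k)))\<^sup>2)"
      using c gap_pos by (subst ennreal_plus[symmetric]) auto
    also have "\<dots> \<le> ennreal ((norm (x - y k))\<^sup>2 + drift)" by (intro ennreal_leI one_step_estimate)
    finally show ?thesis .
  qed
  from nn_integral_sample_le[OF h _ this, of k]
  have "(\<integral>\<^sup>+\<omega>. h (z k \<omega>, X k \<omega>) \<partial>M) \<le> (\<integral>\<^sup>+\<omega>. ennreal ((norm (z k \<omega> - y k))\<^sup>2 + drift) \<partial>M)" by simp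
  also have "\<dots> = (\<integral>\<^sup>+\<omega>. ennreal ((norm (e k \<omega>))\<^sup>2) \<partial>M) + ennreal drift"
    using drift_nonneg by (simp add: e_def nn_integral_add emeasure_space_1)
  also have "(\<integral>\<^sup>+\<omega>. h (z k \<omega>, X k \<omega>) \<partial>M) =
     (\<integral>\<^sup>+\<omega>. ennreal ((norm (e (Suc k) \<omega>))\<^sup>2) + ennreal (gap * (norm (S (z k \<omega>) - S (y k)))\<^sup>2) \<partial>M)"
    by (simp add: h_def e_step)
  also have "\<dots> = (\<integral>\<^sup>+\<omega>. ennreal ((norm (e (Suc k) \<omega>))\<^sup>2) \<partial>M) + (\<integral>\<^sup>+\<omega>. ennreal (gap * (norm (S (z k \<omega>) - S (y k)))\<^sup>2) \<partial>M)"
    by (rule nn_integral_add) (auto simp: e_def[abs_def])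
  finally show ?thesis .
qed

text \<open>The second moment condition with \<open>a = \<alpha> S (y k)\<close>.\<close>

lemma expected_increment:
  "(\<integral>\<^sup>+\<omega>. ennreal ((norm (e (Suc k) \<omega> - e k \<omega>))\<^sup>2) \<partial>M)
    \<le> (\<integral>\<^sup>+\<omega>. ennreal ((\<alpha>\<^sup>2 + 2 * c) * (norm (S (z k \<omega>) - S (y k)))\<^sup>2 + 2 * c * (norm (S 0))\<^sup>2) \<partial>M)"
proof -
  define h where "h = (\<lambda>(x, s). ennreal ((norm (\<alpha> *\<^sub>R S (y k) - \<Lambda> s (S x)))\<^sup>2))"
  have "(\<lambda>q :: 'a \<times> 's. (snd q, S (fst q))) \<in> borel \<Otimes>\<^sub>M borel \<rightarrow>\<^sub>M borel \<Otimes>\<^sub>M borel" by measurable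
  from measurable_compose[OF this measurable_\<Lambda>]
  have [measurable]: "(\<lambda>q. \<Lambda> (snd q) (S (fst q))) \<in> borel_measurable (borel \<Otimes>\<^sub>M borel)" by simp
  have h: "h \<in> borel_measurable (borel \<Otimes>\<^sub>M borel)" unfolding h_def case_prod_beta by measurable
  have "(\<integral>\<^sup>+s. h (x, s) \<partial>D) \<le> ennreal ((\<alpha>\<^sup>2 + 2 * c) * (norm (S x - S (y k)))\<^sup>2 + 2 * c * (norm (S 0))\<^sup>2)" for x
  proof -
    have "(\<integral>\<^sup>+s. h (x, s) \<partial>D) \<le> ennreal ((norm (\<alpha> *\<^sub>R S (y k) - \<alpha> *\<^sub>R S x))\<^sup>2 + c * (norm (S x))\<^sup>2)"
      unfolding h_def using second_moment[of "\<alpha> *\<^sub>R S (y k)" "S x"] by simp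
    also have "\<dots> \<le> ennreal ((\<alpha>\<^sup>2 + 2 * c) * (norm (S x - S (y k)))\<^sup>2 + 2 * c * (norm (S 0))\<^sup>2)"
    proof (rule ennreal_leI)
      have "(norm (\<alpha> *\<^sub>R S (y k) - \<alpha> *\<^sub>R S x))\<^sup>2 = \<alpha>\<^sup>2 * (norm (S x - S (y k)))\<^sup>2"
        by (simp add: scaleR_diff_right[symmetric] norm_minus_commute power_mult_distrib)
      moreover have "(norm (S x))\<^sup>2 \<le> 2 * (norm (S x - S (y k)))\<^sup>2 + 2 * (norm (S 0))\<^sup>2"
      proof -
        have "norm (S x) \<le> norm (S x - S (y k)) + norm (S 0)"
          using norm_triangle_ineq[of "S x - S (y k)" "S (y k)"] S_y_bound[of k] by simp
        then have "(norm (S x))\<^sup>2 \<le> (norm (S x - S (y k)) + norm (S 0))\<^sup>2" by (intro power_mono) auto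
        also have "\<dots> \<le> 2 * (norm (S x - S (y k)))\<^sup>2 + 2 * (norm (S 0))\<^sup>2"
          using sum_squares_bound[of "norm (S x - S (y k))" "norm (S 0)"] by (simp add: power2_sum)
        finally show ?thesis .
      qed
      then have "c * (norm (S x))\<^sup>2 \<le> c * (2 * (norm (S x - S (y k)))\<^sup>2 + 2 * (norm (S 0))\<^sup>2)"
        using c(1) by (rule mult_left_mono)
      ultimately show "(norm (\<alpha> *\<^sub>R S (y k) - \<alpha> *\<^sub>R S x))\<^sup>2 + c * (norm (S x))\<^sup>2
          \<le> (\<alpha>\<^sup>2 + 2 * c) * (norm (S x - S (y k)))\<^sup>2 + 2 * c * (norm (S 0))\<^sup>2"
        by (simp add: algebra_simps)
    qed
    finally show ?thesis .
  qed
  from nn_integral_sample_le[OF h _ this, of k]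
  have le: "(\<integral>\<^sup>+\<omega>. h (z k \<omega>, X k \<omega>) \<partial>M)
    \<le> (\<integral>\<^sup>+\<omega>. ennreal ((\<alpha>\<^sup>2 + 2 * c) * (norm (S (z k \<omega>) - S (y k)))\<^sup>2 + 2 * c * (norm (S 0))\<^sup>2) \<partial>M)" by simp
  have "h (z k \<omega>, X k \<omega>) = ennreal ((norm (e (Suc k) \<omega> - e k \<omega>))\<^sup>2)" for \<omega>
    by (simp add: h_def e_step) (simp add: e_def algebra_simps)
  then show ?thesis using le by simp
qed

lemma e_second_moment: "(\<integral>\<^sup>+\<omega>. ennreal ((norm (e k \<omega>))\<^sup>2) \<partial>M) \<le> ennreal (drift * real k)"
proof (induction k)
  case (Suc k)
  have "(\<integral>\<^sup>+\<omega>. ennreal ((norm (e (Suc k) \<omega>))\<^sup>2) \<partial>M) \<le> (\<integral>\<^sup>+\<omega>. ennreal ((norm (e k \<omega>))\<^sup>2) \<partial>M) + ennreal drift"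
    by (rule order_trans[OF _ expected_one_step]) simp
  also have "\<dots> \<le> ennreal (drift * real k) + ennreal drift" using Suc by (rule add_right_mono)
  also have "\<dots> = ennreal (drift * real (Suc k))"
    using drift_nonneg by (subst ennreal_plus[symmetric]) (auto simp: algebra_simps)
  finally show ?case .
qed (simp add: e_def z_def)

lemma e_measurable [measurable]: "e k \<in> borel_measurable M"
  unfolding e_def[abs_def] by measurable

text \<open>Weighting the one-step estimate with \<open>(k + 1) powr (- 3/2)\<close> and summing makes the expected squared
  displacement differences summable with these weights, hence also the expected squared increments;
  linear growth of the second moment of \<open>e k\<close> gives the other series required pathwise.\<close>

lemma AE_e_average_tendsto_zero: "AE \<omega> in M. (\<lambda>k. (1 / real k) *\<^sub>R e k \<omega>) \<longlonglongrightarrow> 0"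
proof -
  define m where "m k = enn2real (\<integral>\<^sup>+\<omega>. ennreal ((norm (e k \<omega>))\<^sup>2) \<partial>M)" for k
  define d where "d k \<omega> = (norm (S (z k \<omega>) - S (y k)))\<^sup>2" for k \<omega>
  define a where "a k = enn2real (\<integral>\<^sup>+\<omega>. ennreal (d k \<omega>) \<partial>M)" for k
  have d[measurable]: "d k \<in> borel_measurable M" for k unfolding d_def[abs_def] by measurable
  have d0: "0 \<le> d k \<omega>" for k \<omega> by (simp add: d_def)
  have m: "(\<integral>\<^sup>+\<omega>. ennreal ((norm (e k \<omega>))\<^sup>2) \<partial>M) = ennreal (m k)" for k
    using e_second_moment[of k] unfolding m_def by (auto simp: top_unique less_top[symmetric] intro!: ennreal_enn2real[symmetric])
  have nonneg: "0 \<le> m k" "0 \<le> a k" for k by (auto simp: m_def a_def)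
  have gapd: "(\<integral>\<^sup>+\<omega>. ennreal (gap * d k \<omega>) \<partial>M) = ennreal gap * (\<integral>\<^sup>+\<omega>. ennreal (d k \<omega>) \<partial>M)" for k
    using gap_pos d0 by (simp add: ennreal_mult nn_integral_cmult)
  have one: "ennreal (m (Suc k)) + ennreal gap * (\<integral>\<^sup>+\<omega>. ennreal (d k \<omega>) \<partial>M) \<le> ennreal (m k + drift)" for k
    using expected_one_step[of k] drift_nonneg nonneg
    unfolding m gapd[unfolded d_def] d_def by simp
  have a: "(\<integral>\<^sup>+\<omega>. ennreal (d k \<omega>) \<partial>M) = ennreal (a k)" for k
  proof -
    have "(\<integral>\<^sup>+\<omega>. ennreal (d k \<omega>) \<partial>M) \<noteq> \<top>"
    proof
      assume "(\<integral>\<^sup>+\<omega>. ennreal (d k \<omega>) \<partial>M) = \<top>"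
      then show False using one[of k] gap_pos by (simp add: ennreal_mult_top top_unique)
    qed
    then show ?thesis unfolding a_def by (simp add: less_top)
  qed
  have drift_real: "m (Suc k) + gap * a k \<le> m k + drift" for k
    using one[of k] gap_pos nonneg drift_nonneg unfolding a
    by (simp flip: ennreal_mult ennreal_plus)
  define w where "w k = 1 / sqrt (real (Suc k)) ^ 3" for k
  have w0: "0 \<le> w k" for k by (simp add: w_def)
  have "decseq w" unfolding w_def decseq_Suc_iff
    by (intro allI divide_left_mono power_mono mult_pos_pos) auto
  moreover have sw: "summable w" unfolding w_def by (rule summable_inverse_sqrt_cubed)
  moreover have "m 0 = 0" by (simp add: m_def e_def z_def)
  ultimately have swa: "summable (\<lambda>k. w k * a k)"
    using nonneg w0 drift_nonneg gap_pos by (intro weighted_drift_summable[where m=m and a=a, OF drift_real]) auto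
  have A1: "AE \<omega> in M. summable (\<lambda>k. (norm (e k \<omega>))\<^sup>2 / sqrt (real (Suc k)) ^ 5)"
  proof (rule AE_summable_of_nn_integral_le)
    fix k
    let ?r = "sqrt (real (Suc k))"
    have "(\<integral>\<^sup>+\<omega>. ennreal ((norm (e k \<omega>))\<^sup>2 / ?r ^ 5) \<partial>M) = (\<integral>\<^sup>+\<omega>. ennreal (1 / ?r ^ 5) * ennreal ((norm (e k \<omega>))\<^sup>2) \<partial>M)"
      by (intro nn_integral_cong) (simp flip: ennreal_mult)
    also have "\<dots> = ennreal (1 / ?r ^ 5) * (\<integral>\<^sup>+\<omega>. ennreal ((norm (e k \<omega>))\<^sup>2) \<partial>M)"
      by (rule nn_integral_cmult) simp
    also have "\<dots> \<le> ennreal (1 / ?r ^ 5) * ennreal (drift * real k)"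
      by (intro mult_left_mono e_second_moment) simp
    also have "\<dots> = ennreal (drift * real k / ?r ^ 5)" using drift_nonneg by (simp flip: ennreal_mult)
    also have "\<dots> \<le> ennreal (drift * w k)"
    proof (rule ennreal_leI)
      have "drift * real k / ?r ^ 5 \<le> drift * real (Suc k) / ?r ^ 5"
        using drift_nonneg by (intro divide_right_mono mult_left_mono) auto
      also have "drift * real (Suc k) / ?r ^ 5 = drift * w k"
      proof -
        have "q * r ^ 2 / r ^ 5 = q * (1 / r ^ 3)" if "r \<noteq> 0" for q r :: real
          using that by (simp add: eval_nat_numeral)
        from this[of ?r drift] show ?thesis unfolding w_def by simp
      qed
      finally show "drift * real k / ?r ^ 5 \<le> drift * w k" .
    qed
    finally show "(\<integral>\<^sup>+\<omega>. ennreal ((norm (e k \<omega>))\<^sup>2 / ?r ^ 5) \<partial>M) \<le> ennreal (drift * w k)" .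
  qed (use drift_nonneg w0 sw in \<open>auto intro: summable_mult\<close>)
  have A2: "AE \<omega> in M. summable (\<lambda>k. (norm (e (Suc k) \<omega> - e k \<omega>))\<^sup>2 / sqrt (real (Suc k)) ^ 3)"
  proof (rule AE_summable_of_nn_integral_le)
    let ?A = "\<alpha>\<^sup>2 + 2 * c" and ?B = "2 * c * (norm (S 0))\<^sup>2"
    let ?b = "\<lambda>k. ?A * (w k * a k) + ?B * w k"
    have AB: "?A \<ge> 0" "?B \<ge> 0" using c by auto
    show "summable ?b" using swa sw by (intro summable_add summable_mult)
    show "0 \<le> ?b k" for k using c(1) w0 nonneg by (intro add_nonneg_nonneg mult_nonneg_nonneg) auto
    fix k
    have "(\<integral>\<^sup>+\<omega>. ennreal ((norm (e (Suc k) \<omega> - e k \<omega>))\<^sup>2 / sqrt (real (Suc k)) ^ 3) \<partial>M)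
       = (\<integral>\<^sup>+\<omega>. ennreal (w k) * ennreal ((norm (e (Suc k) \<omega> - e k \<omega>))\<^sup>2) \<partial>M)"
      by (intro nn_integral_cong) (simp add: w_def flip: ennreal_mult)
    also have "\<dots> = ennreal (w k) * (\<integral>\<^sup>+\<omega>. ennreal ((norm (e (Suc k) \<omega> - e k \<omega>))\<^sup>2) \<partial>M)"
      by (rule nn_integral_cmult) simp
    also have "\<dots> \<le> ennreal (w k) * (\<integral>\<^sup>+\<omega>. ennreal (?A * d k \<omega> + ?B) \<partial>M)"
      unfolding d_def by (intro mult_left_mono expected_increment) simp
    also have "(\<integral>\<^sup>+\<omega>. ennreal (?A * d k \<omega> + ?B) \<partial>M) = (\<integral>\<^sup>+\<omega>. ennreal ?A * ennreal (d k \<omega>) + ennreal ?B \<partial>M)"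
      using AB d0 by (intro nn_integral_cong) (simp add: ennreal_mult[symmetric] ennreal_plus[symmetric] del: ennreal_plus)
    also have "\<dots> = (\<integral>\<^sup>+\<omega>. ennreal ?A * ennreal (d k \<omega>) \<partial>M) + (\<integral>\<^sup>+\<omega>. ennreal ?B \<partial>M)"
      by (rule nn_integral_add) auto
    also have "\<dots> = ennreal ?A * ennreal (a k) + ennreal ?B"
      by (simp add: nn_integral_cmult a emeasure_space_1)
    also have "\<dots> = ennreal (?A * a k + ?B)"
      using AB nonneg by (simp add: ennreal_mult[symmetric] ennreal_plus[symmetric] del: ennreal_plus)
    also have "ennreal (w k) * \<dots> = ennreal (w k * (?A * a k + ?B))"
      using w0[of k] by (simp only: ennreal_mult')
    also have "w k * (?A * a k + ?B) = ?b k" by (simp add: algebra_simps)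
    finally show "(\<integral>\<^sup>+\<omega>. ennreal ((norm (e (Suc k) \<omega> - e k \<omega>))\<^sup>2 / sqrt (real (Suc k)) ^ 3) \<partial>M) \<le> ennreal (?b k)" .
  qed auto
  show ?thesis using A1 A2 by eventually_elim (rule scaled_sequence_tendsto_zero)
qed

context
  fixes v :: 'a
  assumes v: "v \<in> closure (range S)" "\<And>q. q \<in> closure (range S) \<Longrightarrow> norm v \<le> norm q"
begin

lemma y_average_tendsto: "(\<lambda>k. (1 / real k) *\<^sub>R y k) \<longlonglongrightarrow> - \<alpha> *\<^sub>R v"
  by (rule relaxed_orbit_average_tendsto[OF firm \<alpha> v])

theorem AE_z_average_tendsto: "AE \<omega> in M. (\<lambda>k. (1 / real k) *\<^sub>R z k \<omega>) \<longlonglongrightarrow> - \<alpha> *\<^sub>R v"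
  using AE_e_average_tendsto_zero
proof eventually_elim
  case (elim \<omega>)
  from tendsto_add[OF this y_average_tendsto] show ?case by (simp add: e_def algebra_simps)
qed

theorem z_average_converges_L2: "converges_L2 M (\<lambda>k \<omega>. (1 / real k) *\<^sub>R z k \<omega>) (- \<alpha> *\<^sub>R v)"
  unfolding converges_L2_def
proof (intro conjI allI)
  have int_e: "integrable M (\<lambda>\<omega>. (norm (e k \<omega>))\<^sup>2)" for k
    using e_second_moment[of k] by (intro integrableI_nonneg) (auto simp: le_less_trans)
  have E_e: "(\<integral>\<omega>. (norm (e k \<omega>))\<^sup>2 \<partial>M) \<le> drift * real k" for k
    using e_second_moment[of k] drift_nonneg by (simp add: nn_integral_eq_integral[OF int_e])
  have bound: "(norm ((1 / real k) *\<^sub>R z k \<omega> - u))\<^sup>2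
      \<le> 2 * (1 / real k)\<^sup>2 * (norm (e k \<omega>))\<^sup>2 + 2 * (norm ((1 / real k) *\<^sub>R y k - u))\<^sup>2" for k \<omega> u
  proof -
    have "(1 / real k) *\<^sub>R z k \<omega> - u = (1 / real k) *\<^sub>R e k \<omega> + ((1 / real k) *\<^sub>R y k - u)"
      by (simp add: e_def algebra_simps)
    then show ?thesis
      by (simp only:) (use norm_add_squared_le[of "(1 / real k) *\<^sub>R e k \<omega>" "(1 / real k) *\<^sub>R y k - u"] in \<open>simp add: power_divide\<close>)
  qed
  have int: "integrable M (\<lambda>\<omega>. (norm ((1 / real k) *\<^sub>R z k \<omega> - u))\<^sup>2)" for k u
    by (rule Bochner_Integration.integrable_bound[where
          f="\<lambda>\<omega>. 2 * (1 / real k)\<^sup>2 * (norm (e k \<omega>))\<^sup>2 + 2 * (norm ((1 / real k) *\<^sub>R y k - u))\<^sup>2"])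
      (use int_e bound in auto)
  show "(\<lambda>\<omega>. (1 / real k) *\<^sub>R z k \<omega>) \<in> borel_measurable M" for k by measurable
  show "integrable M (\<lambda>\<omega>. (norm ((1 / real k) *\<^sub>R z k \<omega>))\<^sup>2)" for k using int[of k 0] by simp
  let ?I = "\<lambda>k. \<integral>\<omega>. (norm ((1 / real k) *\<^sub>R z k \<omega> - - \<alpha> *\<^sub>R v))\<^sup>2 \<partial>M"
  let ?u = "\<lambda>k. 2 * drift * (1 / real k) + 2 * (norm ((1 / real k) *\<^sub>R y k - - \<alpha> *\<^sub>R v))\<^sup>2"
  have up: "?I k \<le> ?u k" for k
  proof -
    have "?I k \<le> (\<integral>\<omega>. 2 * (1 / real k)\<^sup>2 * (norm (e k \<omega>))\<^sup>2 + 2 * (norm ((1 / real k) *\<^sub>R y k - - \<alpha> *\<^sub>R v))\<^sup>2 \<partial>M)"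
      by (intro integral_mono int bound) (use int_e in auto)
    also have "\<dots> = 2 * (1 / real k)\<^sup>2 * (\<integral>\<omega>. (norm (e k \<omega>))\<^sup>2 \<partial>M) + 2 * (norm ((1 / real k) *\<^sub>R y k - - \<alpha> *\<^sub>R v))\<^sup>2"
      using int_e by (subst Bochner_Integration.integral_add) (auto simp: prob_space)
    also have "\<dots> \<le> 2 * (1 / real k)\<^sup>2 * (drift * real k) + 2 * (norm ((1 / real k) *\<^sub>R y k - - \<alpha> *\<^sub>R v))\<^sup>2"
      by (intro add_right_mono mult_left_mono E_e) auto
    also have "2 * (1 / real k)\<^sup>2 * (drift * real k) = 2 * drift * (1 / real k)"
      by (simp add: power2_eq_square)
    finally show ?thesis .
  qed
  have "(\<lambda>k. norm ((1 / real k) *\<^sub>R y k - - \<alpha> *\<^sub>R v)) \<longlonglongrightarrow> 0"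
    using y_average_tendsto by (simp only: tendsto_norm_zero_iff LIM_zero_iff)
  then have "?u \<longlonglongrightarrow> 2 * drift * 0 + 2 * 0\<^sup>2" by (intro tendsto_intros lim_1_over_n)
  then have "?u \<longlonglongrightarrow> 0" by simp
  then show "?I \<longlonglongrightarrow> 0"
    by (rule tendsto_sandwich[OF _ _ tendsto_const, rotated 2]) (use up in auto)
qed

end

end

lemma converges_L2_bounded_linear:
  fixes P :: "'a::euclidean_space \<Rightarrow> 'b::euclidean_space"
  assumes M: "finite_measure M" and P: "bounded_linear P" and Z: "converges_L2 M Z c"
  shows "converges_L2 M (\<lambda>k \<omega>. P (Z k \<omega>)) (P c)"
proof -
  interpret finite_measure M by (rule M)
  obtain K where K: "\<And>x. norm (P x) \<le> norm x * K" using bounded_linear.bounded[OF P] by blast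
  have K2: "(norm (P x))\<^sup>2 \<le> K\<^sup>2 * (norm x)\<^sup>2" for x
    using power_mono[OF K norm_ge_zero, of x 2] by (simp add: power_mult_distrib mult.commute)
  have Zm: "Z k \<in> borel_measurable M" and Zi: "integrable M (\<lambda>\<omega>. (norm (Z k \<omega>))\<^sup>2)" for k
    using Z by (auto simp: converges_L2_def)
  have lim: "(\<lambda>k. \<integral>\<omega>. (norm (Z k \<omega> - c))\<^sup>2 \<partial>M) \<longlonglongrightarrow> 0" using Z by (simp add: converges_L2_def)
  have [measurable]: "P \<in> borel_measurable borel"
    by (intro borel_measurable_continuous_onI linear_continuous_on P)
  note Zm[measurable]
  have int: "integrable M (\<lambda>\<omega>. (norm (Z k \<omega> - c))\<^sup>2)" for k
    by (rule Bochner_Integration.integrable_bound[where f="\<lambda>\<omega>. 2 * (norm (Z k \<omega>))\<^sup>2 + 2 * (norm c)\<^sup>2"])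
      (use Zi[of k] norm_add_squared_le[of "Z k _" "- c"] in auto)
  have int_P: "integrable M (\<lambda>\<omega>. (norm (P (Y \<omega>)))\<^sup>2)"
    if [measurable]: "Y \<in> borel_measurable M" and "integrable M (\<lambda>\<omega>. (norm (Y \<omega>))\<^sup>2)" for Y
    by (rule Bochner_Integration.integrable_bound[where f="\<lambda>\<omega>. K\<^sup>2 * (norm (Y \<omega>))\<^sup>2"]) (use K2 that in auto)
  show ?thesis unfolding converges_L2_def
  proof (intro conjI allI)
    show "(\<lambda>\<omega>. P (Z k \<omega>)) \<in> borel_measurable M" for k by measurable
    show "integrable M (\<lambda>\<omega>. (norm (P (Z k \<omega>)))\<^sup>2)" for k using int_P[OF Zm Zi] .
    have up: "(\<integral>\<omega>. (norm (P (Z k \<omega>) - P c))\<^sup>2 \<partial>M) \<le> K\<^sup>2 * (\<integral>\<omega>. (norm (Z k \<omega> - c))\<^sup>2 \<partial>M)" for k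
    proof -
      have "(\<integral>\<omega>. (norm (P (Z k \<omega>) - P c))\<^sup>2 \<partial>M) = (\<integral>\<omega>. (norm (P (Z k \<omega> - c)))\<^sup>2 \<partial>M)"
        using P by (simp add: linear_diff bounded_linear.linear)
      also have "\<dots> \<le> (\<integral>\<omega>. K\<^sup>2 * (norm (Z k \<omega> - c))\<^sup>2 \<partial>M)"
        by (intro integral_mono int_P) (use int K2 in auto)
      finally show ?thesis by simp
    qed
    have "(\<lambda>k. K\<^sup>2 * (\<integral>\<omega>. (norm (Z k \<omega> - c))\<^sup>2 \<partial>M)) \<longlonglongrightarrow> K\<^sup>2 * 0" by (intro tendsto_intros lim)
    then have z: "(\<lambda>k. K\<^sup>2 * (\<integral>\<omega>. (norm (Z k \<omega> - c))\<^sup>2 \<partial>M)) \<longlonglongrightarrow> 0" by simp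
    show "(\<lambda>k. \<integral>\<omega>. (norm (P (Z k \<omega>) - P c))\<^sup>2 \<partial>M) \<longlonglongrightarrow> 0"
      by (rule tendsto_sandwich[OF _ _ tendsto_const z]) (use up in auto)
  qed
qed

section \<open>The PG-EXTRA operator\<close>

lemma mixing_matrix_sqrt:
  fixes W :: "real^'m::finite^'m"
  assumes "mixing_matrix N W"
  shows "transpose (U_of W) = U_of W"
    and "U_of W ** (U_of W ** (x :: real^'d^'m)) = (1/2) *\<^sub>R (x - W ** x)"
proof -
  have sym: "transpose W = W" and ev: "\<And>l. l \<in> eigenvalues W \<Longrightarrow> \<bar>l\<bar> \<le> 1"
    using assms by (auto simp: mixing_matrix_def)
  obtain l where l: "l \<in> eigenvalues W" "\<And>x. x \<bullet> (W *v x) \<le> l * (norm x)\<^sup>2"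
    using rayleigh_le_eigenvalue[OF sym] by metis
  have "x \<bullet> (W *v x) \<le> (norm x)\<^sup>2" for x
  proof -
    have "l * (norm x)\<^sup>2 \<le> 1 * (norm x)\<^sup>2" using ev[OF l(1)] by (intro mult_right_mono) auto
    then show ?thesis using l(2)[of x] by simp
  qed
  then have "psd ((1/2) *\<^sub>R (mat 1 - W))"
    using sym
    by (simp add: psd_def transpose_scalar[symmetric] scaleR_matrix_vector_assoc[symmetric]
        matrix_vector_mult_diff_rdistrib inner_diff_right dot_square_norm)
       (simp add: vec_eq_iff transpose_def mat_def)
  note U = psd_sqrt_correct[OF this, folded U_of_def]
  show "transpose (U_of W) = U_of W" using U(1) by (simp add: psd_def)
  have "U_of W ** (U_of W ** x) = ((1/2) *\<^sub>R (mat 1 - W)) ** x"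
    by (simp add: matrix_mul_assoc U(2))
  also have "\<dots> = (1/2) *\<^sub>R (x - W ** x)"
  proof -
    have "((1/2) *\<^sub>R (mat 1 - W)) ** x = (1/2) *\<^sub>R (mat 1 ** x - W ** x)"
      by (simp add: vec_eq_iff matrix_matrix_mult_def sum_subtractf[symmetric] sum_distrib_left
          left_diff_distrib right_diff_distrib mult.assoc)
    then show ?thesis by simp
  qed
  finally show "U_of W ** (U_of W ** x) = (1/2) *\<^sub>R (x - W ** x)" .
qed

text \<open>The Gram operator of \<open>norm_M\<close>.\<close>

definition metric_op :: "real \<Rightarrow> real^'m^'m \<Rightarrow> (real^'d^'m) \<times> (real^'d^'m) \<Rightarrow> (real^'d^'m) \<times> (real^'d^'m)" where
  "metric_op \<tau> U = (\<lambda>(x, u). ((1/\<tau>) *\<^sub>R x + U ** u, U ** x + \<tau> *\<^sub>R u))"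

locale pg_extra =
  fixes f :: "'m::finite \<Rightarrow> real^'d \<Rightarrow> ereal" and N :: "'m \<Rightarrow> 'm set" and W :: "real^'m^'m" and \<tau> :: real
  assumes f: "\<And>i. closed_fun (f i)" "\<And>i. convex_fun (f i)" "\<And>i. proper_fun (f i)"
    and \<tau>: "\<tau> > 0" and mix: "mixing_matrix N W" and min_eig: "min_eigenvalue W > - 1"
begin

abbreviation U :: "real^'m^'m" where "U \<equiv> U_of W"

abbreviation metric :: "(real^'d^'m) \<times> (real^'d^'m) \<Rightarrow> (real^'d^'m) \<times> (real^'d^'m)" where
  "metric \<equiv> metric_op \<tau> U"

text \<open>The smallest eigenvalue of \<open>I - U\<^sup>2 = (I + W) / 2\<close>.\<close>

definition \<kappa> :: real where "\<kappa> = (1 + min_eigenvalue W) / 2"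

lemma \<kappa>_pos: "\<kappa> > 0" using min_eig by (simp add: \<kappa>_def)

lemma linear_U: "linear (\<lambda>x :: real^'d^'m. U ** x)" by (rule linear_matrix_mult_left)

lemmas U_diff = linear_diff[OF linear_U]
  and U_add = linear_add[OF linear_U]
  and U_scaleR = linear_scale[OF linear_U]

lemma U_selfadjoint: "(U ** x) \<bullet> y = x \<bullet> (U ** y)" for x y :: "real^'d^'m"
  by (rule symmetric_matrix_mult_selfadjoint[OF mixing_matrix_sqrt(1)[OF mix]])

lemma U_U: "U ** (U ** x) = (1/2) *\<^sub>R (x - W ** x)" for x :: "real^'d^'m"
  by (rule mixing_matrix_sqrt(2)[OF mix])

lemma norm_U_le: "(norm (U ** x))\<^sup>2 \<le> (1 - \<kappa>) * (norm x)\<^sup>2" for x :: "real^'d^'m"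
proof -
  have "transpose W = W" using mix by (simp add: mixing_matrix_def)
  from min_eigenvalue_le_rayleigh_columns[OF this, of x]
  have "(1/2) * (min_eigenvalue W * (norm x)\<^sup>2) \<le> (1/2) * (x \<bullet> (W ** x))" by simp
  moreover have "(norm (U ** x))\<^sup>2 = (1/2) * ((norm x)\<^sup>2 - x \<bullet> (W ** x))"
    unfolding power2_norm_eq_inner U_selfadjoint U_U by (simp add: inner_diff_right)
  ultimately show ?thesis by (simp add: \<kappa>_def field_simps)
qed

lemma metric_linear: "linear metric"
  by (rule linearI) (auto simp: metric_op_def U_add U_scaleR algebra_simps)

lemma metric_selfadjoint: "metric p \<bullet> q = p \<bullet> metric q"
  by (cases p; cases q)
    (simp add: metric_op_def inner_add_left inner_add_right U_selfadjoint)

text \<open>Complete the square in \<open>u\<close>; what remains is the quadratic form of \<open>I - U\<^sup>2\<close>.\<close>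

lemma metric_lower_primal: "\<kappa> / \<tau> * (norm (fst p))\<^sup>2 \<le> p \<bullet> metric p"
proof -
  obtain x u where p: "p = (x, u)" by force
  have "p \<bullet> metric p = (1/\<tau>) * (norm x)\<^sup>2 + 2 * ((U ** x) \<bullet> u) + \<tau> * (norm u)\<^sup>2"
    using U_selfadjoint[of x u]
    by (simp add: p metric_op_def inner_add_right dot_square_norm inner_commute)
  moreover have "(norm (U ** x + \<tau> *\<^sub>R u))\<^sup>2 = (norm (U ** x))\<^sup>2 + 2 * \<tau> * ((U ** x) \<bullet> u) + \<tau>\<^sup>2 * (norm u)\<^sup>2"
    unfolding power2_norm_eq_inner
    by (simp add: inner_add_left inner_add_right inner_commute power2_eq_square algebra_simps)
  ultimately have "\<tau> * (p \<bullet> metric p) = (norm (U ** x + \<tau> *\<^sub>R u))\<^sup>2 + ((norm x)\<^sup>2 - (norm (U ** x))\<^sup>2)"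
    using \<tau> by (simp add: algebra_simps power2_eq_square)
  moreover have "\<kappa> * (norm x)\<^sup>2 \<le> (norm x)\<^sup>2 - (norm (U ** x))\<^sup>2"
    using norm_U_le[of x] by (simp add: algebra_simps)
  ultimately have "\<kappa> * (norm x)\<^sup>2 \<le> \<tau> * (p \<bullet> metric p)"
    using zero_le_power2[of "norm (U ** x + \<tau> *\<^sub>R u)"] by linarith
  then show ?thesis using \<tau> by (simp add: p field_simps)
qed

lemma metric_lower_dual: "\<kappa> * \<tau> * (norm (snd p))\<^sup>2 \<le> p \<bullet> metric p"
proof -
  obtain x u where p: "p = (x, u)" by force
  have "p \<bullet> metric p = (1/\<tau>) * (norm x)\<^sup>2 + 2 * (x \<bullet> (U ** u)) + \<tau> * (norm u)\<^sup>2"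
    using U_selfadjoint[of x u]
    by (simp add: p metric_op_def inner_add_right dot_square_norm inner_commute)
  moreover have "(norm (x + \<tau> *\<^sub>R (U ** u)))\<^sup>2 = (norm x)\<^sup>2 + 2 * \<tau> * (x \<bullet> (U ** u)) + \<tau>\<^sup>2 * (norm (U ** u))\<^sup>2"
    unfolding power2_norm_eq_inner
    by (simp add: inner_add_left inner_add_right inner_commute power2_eq_square algebra_simps)
  ultimately have "p \<bullet> metric p = (norm (x + \<tau> *\<^sub>R (U ** u)))\<^sup>2 / \<tau> + \<tau> * ((norm u)\<^sup>2 - (norm (U ** u))\<^sup>2)"
    using \<tau> by (simp add: field_simps power2_eq_square)
  moreover have "\<tau> * (\<kappa> * (norm u)\<^sup>2) \<le> \<tau> * ((norm u)\<^sup>2 - (norm (U ** u))\<^sup>2)"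
    using norm_U_le[of u] \<tau> by (intro mult_left_mono) (auto simp: algebra_simps)
  moreover have "0 \<le> (norm (x + \<tau> *\<^sub>R (U ** u)))\<^sup>2 / \<tau>" using \<tau> by simp
  ultimately show ?thesis by (simp add: p mult_ac)
qed

lemma metric_positive: "p \<noteq> 0 \<Longrightarrow> 0 < p \<bullet> metric p"
proof -
  assume "p \<noteq> 0"
  then consider "fst p \<noteq> 0" | "snd p \<noteq> 0" by (metis prod.collapse zero_prod_def)
  then show ?thesis
  proof cases
    case 1
    then have "0 < \<kappa> / \<tau> * (norm (fst p))\<^sup>2" using \<kappa>_pos \<tau> by simp
    then show ?thesis using metric_lower_primal[of p] by linarith
  next
    case 2
    then have "0 < \<kappa> * \<tau> * (norm (snd p))\<^sup>2" using \<kappa>_pos \<tau> by simp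
    then show ?thesis using metric_lower_dual[of p] by linarith
  qed
qed

lemma norm_M_eq_sqrt_metric: "norm_M \<tau> W p = sqrt (p \<bullet> metric p)"
proof -
  obtain x u where p: "p = (x, u)" by force
  have "u \<bullet> (U ** x) = x \<bullet> (U ** u)" using U_selfadjoint[of u x] by (simp only: inner_commute)
  then show ?thesis
    by (simp add: p norm_M_def metric_op_def trace_transpose_mult_eq_inner inner_add_right dot_square_norm)
qed

definition T :: "(real^'d^'m) \<times> (real^'d^'m) \<Rightarrow> (real^'d^'m) \<times> (real^'d^'m)" where
  "T = pg_extra_op \<tau> f W"

definition S :: "(real^'d^'m) \<times> (real^'d^'m) \<Rightarrow> (real^'d^'m) \<times> (real^'d^'m)" where
  "S p = p - T p"

text \<open>Since \<open>W = I - 2 U\<^sup>2\<close>, the operator \<open>T\<close> is the resolvent of a monotone operator in the metric. In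
  the difference of the two sides all terms cancel except
  \<open>(a - a' - dp) \<bullet> dp / \<tau>\<close>, which is nonnegative by firm nonexpansiveness of the proximal operator.\<close>

lemma displacement_firm: "(S p - S q) \<bullet> metric (S p - S q) \<le> (S p - S q) \<bullet> metric (p - q)"
proof -
  obtain x u where p: "p = (x, u)" by force
  obtain x' u' where q: "q = (x', u')" by force
  define a where "a = W ** x - \<tau> *\<^sub>R (U ** u)"
  define a' where "a' = W ** x' - \<tau> *\<^sub>R (U ** u')"
  define dx where "dx = x - x'"
  define du where "du = u - u'"
  define dp where "dp = prox_rows \<tau> f a - prox_rows \<tau> f a'"
  define g where "g = du + (1/\<tau>) *\<^sub>R (U ** dx)"
  have firm: "0 \<le> (a - a' - dp) \<bullet> dp"
    using prox_rows_firmly_nonexpansive[where f=f and y=a and z=a', OF f \<tau>]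
    by (simp add: dp_def inner_diff_left power2_norm_eq_inner)
  have Wdx: "W ** dx = dx - 2 *\<^sub>R (U ** (U ** dx))" by (simp add: U_U)
  have "a - a' = W ** dx - \<tau> *\<^sub>R (U ** du)"
    by (simp add: a_def a'_def dx_def du_def U_diff linear_diff[OF linear_matrix_mult_left] algebra_simps)
  then have a: "a - a' = dx - 2 *\<^sub>R (U ** (U ** dx)) - \<tau> *\<^sub>R (U ** du)" by (simp add: Wdx)
  have dS: "S p - S q = (dx - dp, - ((1/\<tau>) *\<^sub>R (U ** dx)))"
    by (simp add: S_def T_def pg_extra_op_def p q dx_def dp_def a_def a'_def U_diff algebra_simps)
  have rest: "(p - q) - (S p - S q) = (dp, g)"
    unfolding dS by (simp add: p q dx_def[symmetric] du_def[symmetric] g_def)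
  have "(S p - S q) \<bullet> metric (dp, g)
      = (1/\<tau>) * ((dx - dp) \<bullet> dp) + (dx - dp) \<bullet> (U ** g) - (1/\<tau>) * ((U ** dx) \<bullet> (U ** dp)) - (U ** dx) \<bullet> g"
    unfolding dS using \<tau> by (simp add: metric_op_def inner_add_right algebra_simps)
  also have "\<dots> = (1/\<tau>) * ((a - a' - dp) \<bullet> dp)"
    unfolding a g_def U_add U_scaleR using \<tau>
      U_selfadjoint[of dx dp] U_selfadjoint[of dx du] U_selfadjoint[of dx "U ** dx"] U_selfadjoint[of "U ** dx" dp]
    by (simp add: inner_add_left inner_add_right inner_diff_left inner_diff_right inner_commute field_simps)
  also have "\<dots> \<ge> 0" using firm \<tau> by simp
  finally have "0 \<le> (S p - S q) \<bullet> metric ((p - q) - (S p - S q))" unfolding rest .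
  then show ?thesis by (simp only: linear_diff[OF metric_linear] inner_diff_right)
qed

end

section \<open>RC-PG-EXTRA as a randomized fixed-point iteration\<close>

text \<open>An affine majorant on the unit cube suffices, because its expectation depends on \<open>D\<close> through the
  mean \<open>\<alpha> 1\<close> only.\<close>

lemma expectation_affine_le:
  fixes D :: "(real^'m::finite) measure" and b :: "'m \<Rightarrow> real"
  assumes D: "uniform_expected_step_size \<alpha> D"
    and le: "\<And>s. (\<And>i. 0 \<le> s $ i \<and> s $ i \<le> 1) \<Longrightarrow> 0 \<le> h s \<and> h s \<le> c + (\<Sum>i\<in>UNIV. b i * s $ i)"
  shows "(\<integral>\<^sup>+s. ennreal (h s) \<partial>D) \<le> ennreal (c + (\<Sum>i\<in>UNIV. b i * \<alpha>))"
proof -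
  interpret prob_space D using D by (simp add: uniform_expected_step_size_def)
  have [measurable_cong]: "sets D = sets borel"
    and box: "AE s in D. \<forall>i. 0 \<le> s $ i \<and> s $ i \<le> 1" and mean: "(\<integral>s. s \<partial>D) = \<alpha> *\<^sub>R vec 1"
    using D by (auto simp: uniform_expected_step_size_def)
  have int: "integrable D (\<lambda>s. s)"
  proof (rule integrable_const_bound)
    show "AE s in D. norm s \<le> real CARD('m)"
      using box
    proof eventually_elim
      case (elim s)
      have "norm s \<le> (\<Sum>i\<in>UNIV. \<bar>s $ i\<bar>)" by (rule norm_le_l1_cart)
      also have "\<dots> \<le> (\<Sum>i\<in>(UNIV :: 'm set). 1)" using elim by (intro sum_mono) auto
      finally show ?case by simp
    qed
  qed measurable
  have int_i: "integrable D (\<lambda>s. s $ i)" for i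
    by (rule integrable_bounded_linear[OF bounded_linear_vec_nth int])
  have mean_i: "(\<integral>s. s $ i \<partial>D) = \<alpha>" for i
    using integral_bounded_linear[OF bounded_linear_vec_nth int, of i] by (simp add: mean)
  let ?l = "\<lambda>s :: real^'m. c + (\<Sum>i\<in>UNIV. b i * s $ i)"
  have int_l: "integrable D ?l" using int_i by auto
  have "(\<integral>\<^sup>+s. ennreal (h s) \<partial>D) \<le> (\<integral>\<^sup>+s. ennreal (?l s) \<partial>D)"
    by (rule nn_integral_mono_AE) (use box le in \<open>auto intro!: ennreal_leI\<close>)
  also have "\<dots> = ennreal (\<integral>s. ?l s \<partial>D)"
  proof (rule nn_integral_eq_integral[OF int_l])
    show "AE s in D. 0 \<le> ?l s" using box by eventually_elim (use le order_trans in blast)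
  qed
  also have "(\<integral>s. ?l s \<partial>D) = c + (\<Sum>i\<in>UNIV. b i * \<alpha>)"
    using int_i by (simp add: Bochner_Integration.integral_add Bochner_Integration.integral_sum mean_i prob_space)
  finally show ?thesis .
qed

definition block_scaling :: "real \<Rightarrow> real^'m \<Rightarrow> (real^'d^'m::finite) \<times> (real^'d^'m) \<Rightarrow> (real^'d^'m) \<times> (real^'d^'m)" where
  "block_scaling \<alpha> s p = ((\<chi> i. s $ i *\<^sub>R fst p $ i), \<alpha> *\<^sub>R snd p)"

context pg_extra
begin

text \<open>Only the primal part \<open>r\<close> is random, with a variance of at most \<open>\<alpha> (1 - \<alpha>)\<close> per
  block, and \<open>metric_lower_primal\<close> compares \<open>\<bar>x\<bar>\<^sup>2 / \<tau>\<close> with the metric at the cost of \<open>1 / \<kappa>\<close>. This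
  is where the least eigenvalue of \<open>W\<close> enters.\<close>

lemma block_scaling_second_moment:
  fixes p q :: "(real^'d^'m) \<times> (real^'d^'m)"
  assumes D: "uniform_expected_step_size \<alpha> D" and \<alpha>: "0 < \<alpha>" "\<alpha> \<le> 1"
  shows "(\<integral>\<^sup>+s. ennreal ((p - block_scaling \<alpha> s q) \<bullet> metric (p - block_scaling \<alpha> s q)) \<partial>D)
    \<le> ennreal ((p - \<alpha> *\<^sub>R q) \<bullet> metric (p - \<alpha> *\<^sub>R q) + \<alpha> * (1 - \<alpha>) / \<kappa> * (q \<bullet> metric q))"
proof -
  define a where "a = p - \<alpha> *\<^sub>R q"
  define g where "g = fst (metric a)"
  define x where "x = fst q"
  define b where "b i = - 2 * (x $ i \<bullet> g $ i) + (1 - 2 * \<alpha>) * (norm (x $ i))\<^sup>2 / \<tau>" for i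
  define c where "c = a \<bullet> metric a + (\<Sum>i\<in>UNIV. 2 * \<alpha> * (x $ i \<bullet> g $ i) + \<alpha>\<^sup>2 * (norm (x $ i))\<^sup>2 / \<tau>)"
  have nonneg: "0 \<le> r \<bullet> metric r" for r :: "(real^'d^'m) \<times> (real^'d^'m)"
    using metric_positive[of r] by (cases "r = 0") auto
  have "(\<integral>\<^sup>+s. ennreal ((p - block_scaling \<alpha> s q) \<bullet> metric (p - block_scaling \<alpha> s q)) \<partial>D)
    \<le> ennreal (c + (\<Sum>i\<in>UNIV. b i * \<alpha>))"
  proof (rule expectation_affine_le[OF D], intro conjI nonneg)
    fix s :: "real^'m" assume s: "\<And>i. 0 \<le> s $ i \<and> s $ i \<le> 1"
    define r where "r = (\<chi> i. (s $ i - \<alpha>) *\<^sub>R x $ i)"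
    have split: "p - block_scaling \<alpha> s q = a - (r, 0)"
      by (simp add: a_def r_def x_def block_scaling_def prod_eq_iff vec_eq_iff algebra_simps)
    have rg: "(r, 0) \<bullet> metric a = (\<Sum>i\<in>UNIV. (s $ i - \<alpha>) * (x $ i \<bullet> g $ i))"
      by (cases "metric a") (simp add: g_def r_def inner_vec_def[of "_ :: real^'d^'m"])
    have rr: "(r, 0) \<bullet> metric (r, 0) = (\<Sum>i\<in>UNIV. (s $ i - \<alpha>)\<^sup>2 * (norm (x $ i))\<^sup>2 / \<tau>)"
      by (simp add: metric_op_def r_def inner_vec_def[of "_ :: real^'d^'m"] dot_square_norm
          power2_eq_square sum_divide_distrib linear_0[OF linear_U] mult_ac)
    have "(a - (r, 0)) \<bullet> metric (a - (r, 0)) = a \<bullet> metric a - 2 * ((r, 0) \<bullet> metric a) + (r, 0) \<bullet> metric (r, 0)"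
      using metric_selfadjoint[of a "(r, 0)"]
      by (simp add: linear_diff[OF metric_linear] inner_diff_left inner_diff_right inner_commute)
    also have "(r, 0) \<bullet> metric (r, 0) \<le> (\<Sum>i\<in>UNIV. ((1 - 2 * \<alpha>) * s $ i + \<alpha>\<^sup>2) * (norm (x $ i))\<^sup>2 / \<tau>)"
      unfolding rr
    proof (intro sum_mono divide_right_mono mult_right_mono)
      fix i
      \<comment> \<open>A number in \<open>[0,1]\<close> is at least its square, so the variance is at most \<open>\<alpha> (1 - \<alpha>)\<close>.\<close>
      have "s $ i * s $ i \<le> s $ i" using s[of i] by (simp add: mult_left_le)
      then show "(s $ i - \<alpha>)\<^sup>2 \<le> (1 - 2 * \<alpha>) * s $ i + \<alpha>\<^sup>2" by (simp add: power2_eq_square algebra_simps)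
    qed (use \<tau> in auto)
    also have "a \<bullet> metric a - 2 * ((r, 0) \<bullet> metric a) + (\<Sum>i\<in>UNIV. ((1 - 2 * \<alpha>) * s $ i + \<alpha>\<^sup>2) * (norm (x $ i))\<^sup>2 / \<tau>)
        = c + (\<Sum>i\<in>UNIV. b i * s $ i)"
      unfolding rg c_def b_def
      by (simp add: sum_distrib_left sum.distrib[symmetric] sum_subtractf[symmetric] add.assoc add_diff_eq[symmetric])
         (rule sum.cong; simp add: algebra_simps add_divide_distrib diff_divide_distrib)
    finally show "(p - block_scaling \<alpha> s q) \<bullet> metric (p - block_scaling \<alpha> s q) \<le> c + (\<Sum>i\<in>UNIV. b i * s $ i)"
      unfolding split by simp
  qed
  also have "c + (\<Sum>i\<in>UNIV. b i * \<alpha>) = a \<bullet> metric a + (\<Sum>i\<in>UNIV. \<alpha> * (1 - \<alpha>) * (norm (x $ i))\<^sup>2 / \<tau>)"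
    unfolding c_def b_def add.assoc sum.distrib[symmetric]
    by (intro arg_cong2[where f="(+)"] refl sum.cong)
      (simp add: algebra_simps power2_eq_square add_divide_distrib diff_divide_distrib)
  also have "(\<Sum>i\<in>UNIV. \<alpha> * (1 - \<alpha>) * (norm (x $ i))\<^sup>2 / \<tau>) = \<alpha> * (1 - \<alpha>) / \<kappa> * (\<kappa> / \<tau> * (norm x)\<^sup>2)"
  proof -
    have "(norm x)\<^sup>2 = (\<Sum>i\<in>UNIV. (norm (x $ i))\<^sup>2)"
      unfolding power2_norm_eq_inner by (rule inner_vec_def)
    then show ?thesis using \<kappa>_pos by (simp add: sum_distrib_left sum_divide_distrib mult.assoc)
  qed
  also have "\<dots> \<le> \<alpha> * (1 - \<alpha>) / \<kappa> * (q \<bullet> metric q)"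
    unfolding x_def using \<alpha> \<kappa>_pos by (intro mult_left_mono metric_lower_primal) auto
  finally show ?thesis unfolding a_def by (simp add: ennreal_leI)
qed

text \<open>In the variables \<open>w = \<tau> U u\<close> the dual update of the algorithm is \<open>\<tau> U\<close> applied to the relaxed dual
  step of \<open>T\<close>, by \<open>U\<^sup>2 = (I - W) / 2\<close>; the messages keep the stored vectors equal to \<open>W x\<close>.\<close>

lemma rc_state_eq_randomized_orbit:
  fixes \<alpha> :: real and \<sigma> :: "nat \<Rightarrow> real^'m"
  defines "orb \<equiv> randomized_orbit (block_scaling \<alpha>) S \<sigma>"
  shows "rc_state \<alpha> \<tau> f N W \<sigma> k = (fst (orb k), \<tau> *\<^sub>R (U ** snd (orb k)), W ** fst (orb k))"
proof (induction k)
  case 0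
  show ?case
    by (simp add: orb_def rc_init_def dual_update_def vec_eq_iff linear_0[OF linear_matrix_mult_left])
next
  case (Suc k)
  obtain x u where xu: "orb k = (x, u)" by force
  let ?s = "\<sigma> k"
  let ?d = "prox_rows \<tau> f (W ** x - \<tau> *\<^sub>R (U ** u)) - x"
  let ?x = "\<chi> i. x $ i + ?s $ i *\<^sub>R ?d $ i" and ?u = "u + (\<alpha> / \<tau>) *\<^sub>R (U ** x)"
  have orb: "orb (Suc k) = (?x, ?u)"
    using xu by (simp add: orb_def block_scaling_def S_def T_def pg_extra_op_def vec_eq_iff algebra_simps)
  have delta: "prox \<tau> (f i) ((W ** x) $ i - (\<tau> *\<^sub>R (U ** u)) $ i) - x $ i = ?d $ i" for i
    by (simp add: prox_rows_def)
  have x: "(\<chi> i. if ?s $ i \<noteq> 0 then x $ i + ?s $ i *\<^sub>R ?d $ i else x $ i) = ?x"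
    by (simp add: vec_eq_iff)
  have w: "dual_update \<alpha> x (\<tau> *\<^sub>R (U ** u)) (W ** x) = \<tau> *\<^sub>R (U ** ?u)"
    using \<tau> by (simp add: dual_update_def U_add U_scaleR U_U vec_eq_iff algebra_simps)
  have Wx: "(\<chi> j. (W ** x) $ j + (\<Sum>i | ?s $ i \<noteq> 0 \<and> j \<in> N i \<union> {i}. (W $ i $ j) *\<^sub>R ?s $ i *\<^sub>R ?d $ i)) = W ** ?x"
  proof -
    have Wsym: "W $ i $ j = W $ j $ i" for i j
      using mix unfolding mixing_matrix_def transpose_def by (metis vec_lambda_beta)
    have W0: "W $ i $ j = 0" if "j \<notin> N i \<union> {i}" for i j
      using mix that unfolding mixing_matrix_def by auto
    have "(\<Sum>i | ?s $ i \<noteq> 0 \<and> j \<in> N i \<union> {i}. (W $ i $ j) *\<^sub>R ?s $ i *\<^sub>R ?d $ i)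
        = (\<Sum>i\<in>UNIV. (W $ j $ i) *\<^sub>R ?s $ i *\<^sub>R ?d $ i)" for j
      unfolding Wsym[of _ j]
      by (rule sum.mono_neutral_left) (use W0 Wsym in force)+
    moreover have "(W ** y) $ j = (\<Sum>i\<in>UNIV. (W $ j $ i) *\<^sub>R y $ i)" for y :: "real^'d^'m" and j
      by (simp add: vec_eq_iff matrix_matrix_mult_def)
    ultimately show ?thesis by (simp add: vec_eq_iff sum.distrib scaleR_add_right distrib_left mult.assoc)
  qed
  show ?case
    unfolding rc_state.simps Suc orb xu
    by (simp only: rc_pass_def split_conv Let_def fst_conv snd_conv delta x w Wx)
qed

end

context pg_extra
begin

text \<open>In the coordinates \<open>L\<close> the metric norm is the standard norm and closures are preserved, so the
  minimum is attained and the vector chosen by \<open>infimal_displacement\<close> is a minimiser.\<close>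

lemma infimal_displacement_minimises:
  fixes L L' :: "(real^'d^'m) \<times> (real^'d^'m) \<Rightarrow> (real^'d^'m) \<times> (real^'d^'m)"
  assumes L: "linear L" "linear L'" "\<And>x. L' (L x) = x" "\<And>x. L (L' x) = x"
    "\<And>x y. L x \<bullet> L y = x \<bullet> metric y"
  defines "v \<equiv> infimal_displacement (norm_M \<tau> W) (pg_extra_op \<tau> f W)"
    and "S' \<equiv> \<lambda>a. L (S (L' a))"
  shows "L v \<in> closure (range S')" and "q \<in> closure (range S') \<Longrightarrow> norm (L v) \<le> norm q"
proof -
  let ?C = "closure (range S)"
  have "inj L" using L(3) by (metis injI)
  have "surj L'" using L(3) by (rule surjI)
  have "range S' = L ` S ` range L'" unfolding S'_def by (simp only: image_image)
  then have "range S' = L ` range S" using \<open>surj L'\<close> by simp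
  then have cl: "closure (range S') = L ` ?C"
    using closure_injective_linear_image[OF L(1) \<open>inj L\<close>, of "range S"] by simp
  have nrm: "norm_M \<tau> W p = norm (L p)" for p
    by (simp add: norm_M_eq_sqrt_metric L(5)[symmetric] norm_eq_sqrt_inner)
  obtain w where w: "w \<in> closure (range S')" "\<And>q. q \<in> closure (range S') \<Longrightarrow> norm w \<le> norm q"
    using distance_attains_inf[of "closure (range S')" 0] by (auto simp: dist_norm)
  then obtain p where p: "p \<in> ?C" "w = L p" unfolding cl by blast
  have "is_arg_min (norm_M \<tau> W) (\<lambda>p. p \<in> ?C) p"
    using p w(2) by (auto simp: is_arg_min_def nrm cl not_less)
  then have "is_arg_min (norm_M \<tau> W) (\<lambda>p. p \<in> ?C) v"
    unfolding v_def infimal_displacement_def arg_min_def S_def[abs_def] T_def by (rule someI)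
  then have "v \<in> ?C" "\<And>q. q \<in> ?C \<Longrightarrow> norm (L v) \<le> norm (L q)"
    by (auto simp: is_arg_min_def nrm not_less)
  then show "L v \<in> closure (range S')" "q \<in> closure (range S') \<Longrightarrow> norm (L v) \<le> norm q"
    unfolding cl by auto
qed

end

theorem corollary7p3:
  fixes f :: "'m::finite \<Rightarrow> real^'d \<Rightarrow> ereal"
    and N :: "'m \<Rightarrow> 'm set"
    and W :: "real^'m^'m"
    and \<tau> \<alpha> :: real
    and M :: "'w measure"
    and D :: "(real^'m) measure"
    and \<I> :: "nat \<Rightarrow> 'w \<Rightarrow> real^'m"
  assumes "\<And>i. closed_fun (f i)" "\<And>i. convex_fun (f i)" "\<And>i. proper_fun (f i)"
    and "\<tau> > 0"
    and "\<And>i j. j \<in> N i \<longleftrightarrow> i \<in> N j"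
    and "mixing_matrix N W"
    and "0 < \<alpha>" "\<alpha> \<le> 1"
    and "uniform_expected_step_size \<alpha> D"
    and "prob_space M"
    and "iid_samples M D \<I>"
    and "min_eigenvalue W > - (\<alpha> / (2 - \<alpha>))"
  defines "Z \<equiv> (\<lambda>k \<omega>. (1 / real k) *\<^sub>R rc_iterate \<alpha> \<tau> f N W (\<lambda>n. \<I> n \<omega>) k)"
    and "v \<equiv> pg_extra_infimal_displacement \<tau> f W"
  shows "converges_L2 M Z (- \<alpha> *\<^sub>R v) \<and>
         (AE \<omega> in M. (\<lambda>k. Z k \<omega>) \<longlonglongrightarrow> - \<alpha> *\<^sub>R v)"
proof -
  note \<alpha> = \<open>0 < \<alpha>\<close> \<open>\<alpha> \<le> 1\<close>
  interpret M: prob_space M by (rule assms)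
  have "\<alpha> / (2 - \<alpha>) \<le> 1" using \<alpha> by simp
  then have "min_eigenvalue W > - 1" using assms(12) by linarith
  then interpret P: pg_extra f N W \<tau> by unfold_locales (use assms in auto)
  obtain L L' :: "(real^'d^'m) \<times> (real^'d^'m) \<Rightarrow> (real^'d^'m) \<times> (real^'d^'m)"
    where L: "linear L" "linear L'" "\<And>x. L' (L x) = x" "\<And>x. L (L' x) = x"
      "\<And>x y. L x \<bullet> L y = x \<bullet> P.metric y"
    by (rule positive_definite_isometry[OF P.metric_linear P.metric_selfadjoint P.metric_positive])
      (assumption, rule that)
  have norm_L: "(norm (L x))\<^sup>2 = x \<bullet> P.metric x" for x by (simp add: power2_norm_eq_inner L(5))
  define c where "c = \<alpha> * (1 - \<alpha>) / P.\<kappa>"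
  \<comment> \<open>The eigenvalue condition is equivalent to \<open>(1 - \<alpha>) / (2 - \<alpha>) < \<kappa>\<close>.\<close>
  have c: "0 \<le> c" "c < \<alpha> * (2 - \<alpha>)"
  proof -
    show "0 \<le> c" unfolding c_def using \<alpha> P.\<kappa>_pos by simp
    have "(1 - \<alpha>) / (2 - \<alpha>) < P.\<kappa>"
      using assms(12) \<alpha> by (simp add: P.\<kappa>_def field_simps)
    then have "1 - \<alpha> < (2 - \<alpha>) * P.\<kappa>" using \<alpha> by (simp add: field_simps)
    then have "(1 - \<alpha>) / P.\<kappa> < 2 - \<alpha>" using P.\<kappa>_pos by (simp add: field_simps)
    from mult_strict_left_mono[OF this \<alpha>(1)] show "c < \<alpha> * (2 - \<alpha>)" by (simp add: c_def)
  qed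
  define S where "S a = L (P.S (L' a))" for a
  define \<Lambda> where "\<Lambda> s a = L (block_scaling \<alpha> s (L' a))" for s a
  interpret R: randomized_fixed_point_iteration M S \<Lambda> D \<I> \<alpha> c
  proof
    show "0 < \<alpha>" "\<alpha> \<le> 1" "0 \<le> c" "c < \<alpha> * (2 - \<alpha>)" using \<alpha> c by auto
    show "M.indep_vars (\<lambda>_. borel) \<I> UNIV" "distr M borel (\<I> k) = D" for k
      using assms(11) by (auto simp: iid_samples_def)
    show "(norm (S x - S y))\<^sup>2 \<le> (S x - S y) \<bullet> (x - y)" for x y
    proof -
      have "x - y = L (L' x - L' y)" by (simp add: L(4) linear_diff[OF L(1)])
      then have "(S x - S y) \<bullet> (x - y) = (P.S (L' x) - P.S (L' y)) \<bullet> P.metric (L' x - L' y)"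
        unfolding S_def linear_diff[OF L(1), symmetric] by (simp only: L(5))
      then show ?thesis
        unfolding S_def linear_diff[OF L(1), symmetric] norm_L using P.displacement_firm by simp
    qed
    show "(\<integral>\<^sup>+s. ennreal ((norm (a - \<Lambda> s p))\<^sup>2) \<partial>D) \<le> ennreal ((norm (a - \<alpha> *\<^sub>R p))\<^sup>2 + c * (norm p)\<^sup>2)" for a p
    proof -
      have a: "a - L x = L (L' a - x)" for x by (simp add: L(4) linear_diff[OF L(1)])
      have p: "p = L (L' p)" by (simp add: L(4))
      have "a - \<alpha> *\<^sub>R p = L (L' a - \<alpha> *\<^sub>R L' p)" by (simp add: L(4) linear_diff[OF L(1)] linear_scale[OF L(1)])
      then have "(norm (a - \<alpha> *\<^sub>R p))\<^sup>2 + c * (norm p)\<^sup>2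
          = (L' a - \<alpha> *\<^sub>R L' p) \<bullet> P.metric (L' a - \<alpha> *\<^sub>R L' p) + c * (L' p \<bullet> P.metric (L' p))"
        using norm_L[of "L' p"] by (simp add: norm_L L(4))
      then show ?thesis
        unfolding \<Lambda>_def a norm_L c_def using P.block_scaling_second_moment[OF assms(9) \<alpha>, of "L' a" "L' p"] by simp
    qed
    have blL: "bounded_linear L" and blL': "bounded_linear L'"
      using L(1,2) by (simp_all add: linear_conv_bounded_linear)
    have "continuous_on UNIV (\<lambda>q :: (real^'m) \<times> (real^'d^'m) \<times> (real^'d^'m). block_scaling \<alpha> (fst q) (L' (snd q)))"
      unfolding block_scaling_def
      by (intro continuous_intros continuous_on_vec_lambda bounded_linear.continuous_on[OF blL'])
    then have "continuous_on UNIV (\<lambda>q. \<Lambda> (fst q) (snd q))"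
      unfolding \<Lambda>_def by (rule bounded_linear.continuous_on[OF blL])
    then show "(\<lambda>(s, p). \<Lambda> s p) \<in> borel_measurable (borel \<Otimes>\<^sub>M borel)"
      unfolding borel_prod case_prod_beta by (rule borel_measurable_continuous_onI)
  qed
  have orbit: "L' (randomized_orbit \<Lambda> S \<sigma> k) = randomized_orbit (block_scaling \<alpha>) P.S \<sigma> k" for \<sigma> k
    by (induction k) (auto simp: linear_0[OF L(2)] linear_diff[OF L(2)] \<Lambda>_def S_def L(3))
  define proj where "proj q = (fst q, \<tau> *\<^sub>R (P.U ** snd q))" for q :: "(real^'d^'m) \<times> (real^'d^'m)"
  define Q where "Q a = proj (L' a)" for a
  have "linear proj" unfolding proj_def
    by (rule linearI) (auto simp: P.U_add P.U_scaleR algebra_simps)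
  then have "linear Q" unfolding Q_def using linear_compose[OF L(2)] by (simp add: comp_def)
  then have blQ: "bounded_linear Q" by (simp add: linear_conv_bounded_linear)
  have Z: "Z k \<omega> = Q ((1 / real k) *\<^sub>R R.z k \<omega>)" for k \<omega>
    unfolding Z_def rc_iterate_def P.rc_state_eq_randomized_orbit linear_scale[OF \<open>linear Q\<close>]
    by (simp add: Q_def proj_def R.z_def orbit)
  define v0 where "v0 = infimal_displacement (norm_M \<tau> W) (pg_extra_op \<tau> f W)"
  have Qv: "Q (- \<alpha> *\<^sub>R L v0) = - \<alpha> *\<^sub>R v"
    unfolding linear_scale[OF \<open>linear Q\<close>]
    by (simp add: Q_def L(3) proj_def v_def v0_def pg_extra_infimal_displacement_def case_prod_beta Let_def)
  have v: "L v0 \<in> closure (range S)" "\<And>q. q \<in> closure (range S) \<Longrightarrow> norm (L v0) \<le> norm q"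
    using P.infimal_displacement_minimises[OF L] unfolding v0_def S_def[abs_def] by auto
  show ?thesis
  proof
    show "converges_L2 M Z (- \<alpha> *\<^sub>R v)"
    proof -
      have "Z = (\<lambda>k \<omega>. Q ((1 / real k) *\<^sub>R R.z k \<omega>))" by (intro ext Z)
      then show ?thesis
        using converges_L2_bounded_linear[OF M.finite_measure_axioms blQ R.z_average_converges_L2[OF v]]
        by (simp only: Qv)
    qed
    show "AE \<omega> in M. (\<lambda>k. Z k \<omega>) \<longlonglongrightarrow> - \<alpha> *\<^sub>R v"
    proof -
      have "AE \<omega> in M. (\<lambda>k. (1 / real k) *\<^sub>R R.z k \<omega>) \<longlonglongrightarrow> - \<alpha> *\<^sub>R L v0"
        by (rule R.AE_z_average_tendsto) (use v in auto)
      then show ?thesis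
      proof eventually_elim
        case (elim \<omega>)
        from bounded_linear.tendsto[OF blQ elim] show ?case by (simp only: Z Qv)
      qed
    qed
  qed
qed

end
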